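(* Let $L\in C^1([a,b]\times\mathbb{R}^{2N};\mathbb{R})$, $\mathbf{y}^a\in\mathbb{R}^N$, $l\in\{1,\ldots,N\}$, and $y_i^b\in\mathbb{R}$ for $i\in\{1,\ldots,N\}$, $i\ne l$. Let $\mathbf{y}$ be a local minimizer of $\mathcal{J}(\mathbf{y})=\int_a^bL[\mathbf{y}]^{\alpha,\beta}_{\gamma}(x)\,dx$ over all $\mathbf{y}\in\mathbf{D}$ satisfying $\mathbf{y}(a)=\mathbf{y}^a$ and $y_i(b)=y_i^b$ for $i=1,\ldots,N$, $i\neq l$, with $y_l(b)$ free. Then the following transversality condition holds: $$\Bigl[\gamma_l\,{}_xI_b^{1-\alpha_l}\,\partial_{N+l+1}L[\mathbf{y}]^{\alpha,\beta}_{\gamma}(x)-(1-\gamma_l)\,{}_aI_x^{1-\beta_l}\,\partial_{N+l+1}L[\mathbf{y}]^{\alpha,\beta}_{\gamma}(x)\Bigr]\Big|_{x=b}=0.$$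
   Context: Let $a<b$, $N\in\mathbb{N}$, and $\alpha,\beta,\gamma\in\mathbb{R}^N$ with $\alpha_i,\beta_i\in(0,1)$, $\gamma_i\in[0,1]$. For scalar $\alpha\in(0,1)$, the left and right Riemann--Liouville fractional integrals are ${}_aI_x^{\alpha}f(x)=\frac{1}{\Gamma(\alpha)}\int_a^x(x-t)^{\alpha-1}f(t)\,dt$ and ${}_xI_b^{\alpha}f(x)=\frac{1}{\Gamma(\alpha)}\int_x^b(t-x)^{\alpha-1}f(t)\,dt$. For $f\in AC([a,b])$ (absolutely continuous), the left and right Caputo derivatives are ${}^C_aD_x^{\alpha}f={}_aI_x^{1-\alpha}f'$ and ${}^C_xD_b^{\alpha}f=-\,{}_xI_b^{1-\alpha}f'$. For scalars $\alpha,\beta\in(0,1)$, $\gamma\in[0,1]$ the combined Caputo derivative is ${}^CD^{\alpha,\beta}_{\gamma}=\gamma\,{}^C_aD_x^{\alpha}+(1-\gamma)\,{}^C_xD_b^{\beta}$. For vector parameters and $\mathbf{y}=(y_1,\ldots,y_N)$, ${}^CD^{\alpha,\beta}_{\gamma}\mathbf{y}=[{}^CD^{\alpha_1,\beta_1}_{\gamma_1}y_1,\ldots,{}^CD^{\alpha_N,\beta_N}_{\gamma_N}y_N]$. $\mathbf{D}$ is the set of $\mathbf{y}:[a,b]\to\mathbb{R}^N$ with components in $AC([a,b])$ such that ${}^CD^{\alpha,\beta}_{\gamma}\mathbf{y}$ exists and is continuous on $[a,b]$, with norm $\|\mathbf{y}\|_{1,\infty}=\max_{[a,b]}\|\mathbf{y}(x)\|+\max_{[a,b]}\|{}^CD^{\alpha,\beta}_{\gamma}\mathbf{y}(x)\|$,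 where $\|\cdot\|$ is a norm on $\mathbb{R}^N$. $[\mathbf{y}]^{\alpha,\beta}_{\gamma}(x)=(x,\mathbf{y}(x),{}^CD^{\alpha,\beta}_{\gamma}\mathbf{y}(x))$, and $L[\mathbf{y}]^{\alpha,\beta}_{\gamma}(x)$ is $L$ evaluated at this point. $\partial_iK$ is the partial derivative of $K$ with respect to its $i$th argument (so $\partial_{N+l+1}L$ is with respect to the $l$th component of the fractional derivative). A local minimizer of $\mathcal{J}$ on an admissible set $\mathcal{D}\subset\mathbf{D}$ is $\bar{\mathbf{y}}\in\mathcal{D}$ for which there is $\delta>0$ with $\mathcal{J}(\bar{\mathbf{y}})\le\mathcal{J}(\mathbf{y})$ for all $\mathbf{y}\in\mathcal{D}$ with $\|\mathbf{y}-\bar{\mathbf{y}}\|_{1,\infty}<\delta$. *)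

theory Defs
  imports "HOL-Analysis.Analysis"
begin

definition is_norm :: "('v::real_vector \<Rightarrow> real) \<Rightarrow> bool" where
  "is_norm \<nu> \<longleftrightarrow>
     (\<forall>v. 0 \<le> \<nu> v) \<and> (\<forall>v. \<nu> v = 0 \<longleftrightarrow> v = 0) \<and>
     (\<forall>c v. \<nu> (c *\<^sub>R v) = \<bar>c\<bar> * \<nu> v) \<and> (\<forall>v w. \<nu> (v + w) \<le> \<nu> v + \<nu> w)"

text \<open>A pair \<open>(s, t)\<close> in \<open>P\<close> encodes the subinterval from \<open>s\<close> to \<open>t\<close>.\<close>

definition AC_on :: "real \<Rightarrow> real \<Rightarrow> (real \<Rightarrow> real) \<Rightarrow> bool" where
  "AC_on a b f \<longleftrightarrow>
     (\<forall>\<epsilon>>0. \<exists>\<delta>>0. \<forall>P::(real \<times> real) set.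
        finite P \<and> (\<forall>(s, t)\<in>P. a \<le> s \<and> s < t \<and> t \<le> b) \<and>
        disjoint_family_on (\<lambda>(s, t). {s<..<t}) P \<and> (\<Sum>(s, t)\<in>P. t - s) < \<delta>
        \<longrightarrow> (\<Sum>(s, t)\<in>P. \<bar>f t - f s\<bar>) < \<epsilon>)"

text \<open>At boundary points of \<open>S\<close> the derivative is taken within \<open>S\<close>.\<close>

definition C1_on :: "('v::real_normed_vector \<Rightarrow> real) \<Rightarrow> 'v set \<Rightarrow> bool" where
  "C1_on F S \<longleftrightarrow>
     (\<exists>F' :: 'v \<Rightarrow> 'v \<Rightarrow>\<^sub>L real.
        (\<forall>p\<in>S. (F has_derivative blinfun_apply (F' p)) (at p within S)) \<and> continuous_on S F')"

definition RL_left_int :: "real \<Rightarrow> real \<Rightarrow> (real \<Rightarrow> real) \<Rightarrow> real \<Rightarrow> real" where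
  "RL_left_int a \<alpha> f x =
     1 / Gamma \<alpha> * (LINT t:{a..x}|lebesgue. (x - t) powr (\<alpha> - 1) * f t)"

definition RL_right_int :: "real \<Rightarrow> real \<Rightarrow> (real \<Rightarrow> real) \<Rightarrow> real \<Rightarrow> real" where
  "RL_right_int b \<alpha> f x =
     1 / Gamma \<alpha> * (LINT t:{x..b}|lebesgue. (t - x) powr (\<alpha> - 1) * f t)"

definition RL_left_exists :: "real \<Rightarrow> real \<Rightarrow> (real \<Rightarrow> real) \<Rightarrow> real \<Rightarrow> bool" where
  "RL_left_exists a \<alpha> f x \<longleftrightarrow>
     set_integrable lebesgue {a..x} (\<lambda>t. (x - t) powr (\<alpha> - 1) * f t)"

definition RL_right_exists :: "real \<Rightarrow> real \<Rightarrow> (real \<Rightarrow> real) \<Rightarrow> real \<Rightarrow> bool" where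
  "RL_right_exists b \<alpha> f x \<longleftrightarrow>
     set_integrable lebesgue {x..b} (\<lambda>t. (t - x) powr (\<alpha> - 1) * f t)"

text \<open>For absolutely continuous \<open>f\<close>, \<open>deriv f\<close> is the classical derivative almost
  everywhere; its values elsewhere, including at the endpoints, do not affect the integrals.\<close>

definition caputo_left :: "real \<Rightarrow> real \<Rightarrow> (real \<Rightarrow> real) \<Rightarrow> real \<Rightarrow> real" where
  "caputo_left a \<alpha> f = RL_left_int a (1 - \<alpha>) (deriv f)"

definition caputo_right :: "real \<Rightarrow> real \<Rightarrow> (real \<Rightarrow> real) \<Rightarrow> real \<Rightarrow> real" where
  "caputo_right b \<alpha> f x = - RL_right_int b (1 - \<alpha>) (deriv f) x"

definition ccaputo ::
    "real \<Rightarrow> real \<Rightarrow> real \<Rightarrow> real \<Rightarrow> real \<Rightarrow> (real \<Rightarrow> real) \<Rightarrow> real \<Rightarrow> real" where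
  "ccaputo a b \<alpha> \<beta> \<gamma> f x = \<gamma> * caputo_left a \<alpha> f x + (1 - \<gamma>) * caputo_right b \<beta> f x"

text \<open>The combined derivative exists at \<open>x\<close> when both of its constituents do.\<close>

definition ccaputo_exists ::
    "real \<Rightarrow> real \<Rightarrow> real \<Rightarrow> real \<Rightarrow> (real \<Rightarrow> real) \<Rightarrow> real \<Rightarrow> bool" where
  "ccaputo_exists a b \<alpha> \<beta> f x \<longleftrightarrow>
     RL_left_exists a (1 - \<alpha>) (deriv f) x \<and> RL_right_exists b (1 - \<beta>) (deriv f) x"

definition ccaputo_vec ::
    "real \<Rightarrow> real \<Rightarrow> real^'n \<Rightarrow> real^'n \<Rightarrow> real^'n \<Rightarrow> (real \<Rightarrow> real^'n) \<Rightarrow> real \<Rightarrow> real^'n" where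
  "ccaputo_vec a b \<alpha> \<beta> \<gamma> y x =
     (\<chi> i. ccaputo a b (\<alpha> $ i) (\<beta> $ i) (\<gamma> $ i) (\<lambda>t. y t $ i) x)"

text \<open>Curves are total functions of which only the restriction to \<open>{a..b}\<close> matters.\<close>

definition D_space ::
    "real \<Rightarrow> real \<Rightarrow> real^'n \<Rightarrow> real^'n \<Rightarrow> real^'n \<Rightarrow> (real \<Rightarrow> real^'n) set" where
  "D_space a b \<alpha> \<beta> \<gamma> =
     {y. (\<forall>i. AC_on a b (\<lambda>t. y t $ i)) \<and>
         (\<forall>i. \<forall>x\<in>{a..b}. ccaputo_exists a b (\<alpha> $ i) (\<beta> $ i) (\<lambda>t. y t $ i) x) \<and>
         continuous_on {a..b} (ccaputo_vec a b \<alpha> \<beta> \<gamma> y)}"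

text \<open>On \<open>D_space\<close> both suprema are maxima, the functions being continuous on \<open>{a..b}\<close>.\<close>

definition norm_1_inf ::
    "(real^'n \<Rightarrow> real) \<Rightarrow> real \<Rightarrow> real \<Rightarrow> real^'n \<Rightarrow> real^'n \<Rightarrow> real^'n \<Rightarrow>
     (real \<Rightarrow> real^'n) \<Rightarrow> real" where
  "norm_1_inf \<nu> a b \<alpha> \<beta> \<gamma> y =
     (SUP x\<in>{a..b}. \<nu> (y x)) + (SUP x\<in>{a..b}. \<nu> (ccaputo_vec a b \<alpha> \<beta> \<gamma> y x))"

definition local_minimizer ::
    "((real \<Rightarrow> real^'n) \<Rightarrow> real) \<Rightarrow> ((real \<Rightarrow> real^'n) \<Rightarrow> real) \<Rightarrow> (real \<Rightarrow> real^'n) set \<Rightarrow>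
     (real \<Rightarrow> real^'n) \<Rightarrow> bool" where
  "local_minimizer nrm J A y \<longleftrightarrow>
     y \<in> A \<and> (\<exists>\<delta>>0. \<forall>z\<in>A. nrm (\<lambda>x. z x - y x) < \<delta> \<longrightarrow> J y \<le> J z)"

definition bracket ::
    "real \<Rightarrow> real \<Rightarrow> real^'n \<Rightarrow> real^'n \<Rightarrow> real^'n \<Rightarrow> (real \<Rightarrow> real^'n) \<Rightarrow> real \<Rightarrow>
     real \<times> (real^'n) \<times> (real^'n)" where
  "bracket a b \<alpha> \<beta> \<gamma> y x = (x, y x, ccaputo_vec a b \<alpha> \<beta> \<gamma> y x)"

definition action ::
    "(real \<times> (real^'n) \<times> (real^'n) \<Rightarrow> real) \<Rightarrow> real \<Rightarrow> real \<Rightarrow>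
     real^'n \<Rightarrow> real^'n \<Rightarrow> real^'n \<Rightarrow> (real \<Rightarrow> real^'n) \<Rightarrow> real" where
  "action L a b \<alpha> \<beta> \<gamma> y = (LINT x:{a..b}|lebesgue. L (bracket a b \<alpha> \<beta> \<gamma> y x))"

text \<open>With \<open>N = CARD('n)\<close>, this is \<open>\<partial>\<^bsub>N+l+1\<^esub>\<close>: the arguments are
  numbered \<open>1\<close> for \<open>x\<close>, then \<open>2, \<dots>, N+1\<close> for \<open>u\<close>, then \<open>N+2, \<dots>, 2N+1\<close> for \<open>v\<close>.\<close>

definition partial_v ::
    "'n \<Rightarrow> (real \<times> (real^'n) \<times> (real^'n) \<Rightarrow> real) \<Rightarrow> real \<times> (real^'n) \<times> (real^'n) \<Rightarrow> real" where
  "partial_v l L = (\<lambda>(x, u, v). deriv (\<lambda>s. L (x, u, \<chi> i. if i = l then s else v $ i)) (v $ l))"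

end

theory Submission
  imports Defs
begin

text \<open>The curve is varied in its \<open>l\<close>-th component by multiples of a primitive \<open>\<eta>\<close>, vanishing at
  \<open>a\<close>, of an arbitrary continuous \<open>h\<close>; the value \<open>\<eta> b\<close> is unconstrained. The first variation
  vanishes, and fractional integration by parts (Fubini) puts it into the form
  \<open>integral {a..b} (\<lambda>x. h x * K x) = 0\<close> with \<open>K\<close> continuous, \<open>K\<close> being the sum of the primitive of
  \<open>\<partial>\<^bsub>l+1\<^esub> L\<close> that vanishes at \<open>b\<close> and the bracket of the transversality condition. Taking
  \<open>h = K\<close> gives \<open>K = 0\<close> on \<open>{a..b}\<close>, in particular at \<open>b\<close>.

  The Caputo derivatives of the varied curve involve \<open>deriv (y + c \<eta>)\<close>, which splits as
  \<open>deriv y + c h\<close> only where \<open>y\<close> is differentiable: elsewhere \<open>deriv\<close> has an unspecified value.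
  Hence absolutely continuous functions have to be shown differentiable almost everywhere, which is
  done with the Vitali covering theorem.\<close>

section \<open>Almost everywhere differentiability of absolutely continuous functions\<close>

text \<open>Since \<open>y_l(b)\<close> is free, \<open>h\<close> ranges over all continuous
  functions and not only over those of mean zero. A du Bois-Reymond argument therefore gives
  \<open>K = 0\<close> instead of \<open>K\<close> constant, and no Euler-Lagrange equation with
  fractional derivatives of the partials of \<open>L\<close>, whose existence would be an issue, has
  to be formed: only fractional integrals of continuous functions occur, and these are continuous up
  to \<open>b\<close>. Prescribing the derivative \<open>h\<close> of the variation keeps the varied
  curves in the space: their Caputo derivatives change by fractional integrals of \<open>h\<close>.
  The primitive itself is written as the Riemann-Liouville integral of order 1, so one integration
  by parts formula serves both partial derivatives of \<open>L\<close>. In the differentiability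
  argument, absolute continuity speaks of finite disjoint families only. Vitali coverings are
  therefore cut down to finite families, and the estimates are made on the gaps that these leave,
  which form finite disjoint families again.\<close>

text \<open>\<open>R\<close> consists of the gaps left by \<open>P\<close>. Keeping the telescoping
  identity for every \<phi> allows it to be read twice: with the identity function for lengths and
  with a given function for its increments.\<close>

lemma interval_family_complement:
  fixes s t :: real
  assumes "finite P" "s \<le> t"
    and "\<forall>(u, v)\<in>P. s \<le> u \<and> u < v \<and> v \<le> t"
    and "disjoint_family_on (\<lambda>(u, v). {u<..<v}) P"
  shows "\<exists>R. finite R \<and> (\<forall>(u, v)\<in>R. s \<le> u \<and> u < v \<and> v \<le> t) \<and>
           disjoint_family_on (\<lambda>(u, v). {u<..<v}) R \<and>
           (\<forall>\<phi> :: real \<Rightarrow> real.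
              (\<Sum>(u, v)\<in>P. \<phi> v - \<phi> u) + (\<Sum>(u, v)\<in>R. \<phi> v - \<phi> u) = \<phi> t - \<phi> s)"
  using assms
proof (induction "card P" arbitrary: P t)
  case 0
  then have "P = {}" by simp
  show ?case
  proof (cases "s < t")
    case True
    then show ?thesis using \<open>P = {}\<close>
      by (intro exI[of _ "{(s, t)}"]) (auto simp: disjoint_family_on_def)
  next
    case False
    then show ?thesis using \<open>P = {}\<close> \<open>s \<le> t\<close>
      by (intro exI[of _ "{}"]) (auto simp: disjoint_family_on_def)
  qed
next
  case (Suc n)
  note P = Suc.prems
  have "P \<noteq> {}" using Suc.hyps(2) by auto
  \<comment> \<open>The rightmost member is split off; the induction hypothesis applies to the
    others with right end \<open>u\<close>, and the only new gap is the one from \<open>v\<close> to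
    \<open>t\<close>.\<close>
  define v where "v = Max (snd ` P)"
  have "v \<in> snd ` P" unfolding v_def using \<open>P \<noteq> {}\<close> P(1) by (intro Max_in) auto
  then obtain u where uv: "(u, v) \<in> P" by force
  have max: "v' \<le> v" if "(u', v') \<in> P" for u' v'
    unfolding v_def using P(1) that by (intro Max_ge) force+
  have suvt: "s \<le> u" "u < v" "v \<le> t" using P(3) uv by auto
  define P0 where "P0 = P - {(u, v)}"
  \<comment> \<open>Otherwise a point just below \<open>v'\<close>, hence below \<open>v\<close>,
    would lie in both open intervals.\<close>
  have below: "v' \<le> u" if "(u', v') \<in> P0" for u' v'
  proof (rule ccontr)
    assume "\<not> v' \<le> u"
    have "{u'<..<v'} \<inter> {u<..<v} = {}"
      using P(4) uv that unfolding disjoint_family_on_def P0_def by force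
    moreover have "u' < v'" "v' \<le> v" using P(3) that max unfolding P0_def by auto
    moreover obtain w where "max u u' < w" "w < v'"
      using \<open>\<not> v' \<le> u\<close> \<open>u' < v'\<close> dense[of "max u u'" v'] by auto
    ultimately show False by auto
  qed
  have "\<exists>R. finite R \<and> (\<forall>(u', v')\<in>R. s \<le> u' \<and> u' < v' \<and> v' \<le> u) \<and>
           disjoint_family_on (\<lambda>(u, v). {u<..<v}) R \<and>
           (\<forall>\<phi> :: real \<Rightarrow> real.
              (\<Sum>(u, v)\<in>P0. \<phi> v - \<phi> u) + (\<Sum>(u, v)\<in>R. \<phi> v - \<phi> u) = \<phi> u - \<phi> s)"
  proof (rule Suc.hyps(1))
    show "n = card P0" using Suc.hyps(2) uv P(1) unfolding P0_def by simp
    show "finite P0" using P(1) unfolding P0_def by simp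
    show "s \<le> u" by fact
    show "\<forall>(u', v')\<in>P0. s \<le> u' \<and> u' < v' \<and> v' \<le> u"
      using P(3) below unfolding P0_def by blast
    show "disjoint_family_on (\<lambda>(u, v). {u<..<v}) P0"
      using P(4) unfolding P0_def disjoint_family_on_def by blast
  qed
  then obtain R where R: "finite R" "\<forall>(u', v')\<in>R. s \<le> u' \<and> u' < v' \<and> v' \<le> u"
    "disjoint_family_on (\<lambda>(u, v). {u<..<v}) R"
    "\<And>\<phi> :: real \<Rightarrow> real.
              (\<Sum>(u, v)\<in>P0. \<phi> v - \<phi> u) + (\<Sum>(u, v)\<in>R. \<phi> v - \<phi> u) = \<phi> u - \<phi> s"
    by blast
  have sumP: "(\<Sum>(u, v)\<in>P. \<phi> v - \<phi> u) = (\<phi> v - \<phi> u) + (\<Sum>(u, v)\<in>P0. \<phi> v - \<phi> u)"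
    for \<phi> :: "real \<Rightarrow> real"
    unfolding P0_def using P(1) uv by (subst sum.remove[of _ "(u, v)"]) auto
  show ?case
  proof (cases "v < t")
    case True
    define R' where "R' = insert (v, t) R"
    have "(v, t) \<notin> R" using R(2) suvt by force
    have "disjoint_family_on (\<lambda>(u, v). {u<..<v}) R'"
      unfolding disjoint_family_on_def R'_def
    proof (intro ballI impI)
      fix p q assume "p \<in> insert (v, t) R" "q \<in> insert (v, t) R" "p \<noteq> q"
      moreover have "(case r of (u, v) \<Rightarrow> {u<..<v}) \<inter> {v<..<t} = {}" if "r \<in> R" for r
        using R(2) that suvt by fastforce
      ultimately show "(case p of (u, v) \<Rightarrow> {u<..<v}) \<inter> (case q of (u, v) \<Rightarrow> {u<..<v}) = {}"
        using R(3) unfolding disjoint_family_on_def by fast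
    qed
    moreover have "\<forall>(u', v')\<in>R'. s \<le> u' \<and> u' < v' \<and> v' \<le> t"
      using R(2) suvt True unfolding R'_def by fastforce
    moreover have "(\<Sum>(u, v)\<in>P. \<phi> v - \<phi> u) + (\<Sum>(u, v)\<in>R'. \<phi> v - \<phi> u) = \<phi> t - \<phi> s"
      for \<phi> :: "real \<Rightarrow> real"
      using R(4)[of \<phi>] sumP[of \<phi>] R(1) \<open>(v, t) \<notin> R\<close> unfolding R'_def by simp
    moreover have "finite R'" using R(1) unfolding R'_def by simp
    ultimately show ?thesis by blast
  next
    case False
    then have "v = t" using suvt by simp
    moreover have "\<forall>(u', v')\<in>R. s \<le> u' \<and> u' < v' \<and> v' \<le> t"
      using R(2) suvt by fastforce
    moreover have "(\<Sum>(u, v)\<in>P. \<phi> v - \<phi> u) + (\<Sum>(u, v)\<in>R. \<phi> v - \<phi> u) = \<phi> t - \<phi> s"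
      for \<phi> :: "real \<Rightarrow> real"
      using R(4)[of \<phi>] sumP[of \<phi>] \<open>v = t\<close> by simp
    ultimately show ?thesis using R(1,3) by blast
  qed
qed

text \<open>Closed balls of the line are closed intervals, so the Vitali theorem supplies a
  countable disjoint family covering almost all of \<open>E\<close>. The bound counts
  \<open>E \<inter> {s<..<t}\<close> instead of lengths, so that these pieces can be covered a
  second time with a controlled total loss.\<close>

lemma Vitali_covering_intervals:
  fixes E U :: "real set"
  assumes E: "E \<in> lmeasurable" "E \<subseteq> U" and U: "open U"
    and Q: "\<And>x d. x \<in> E \<Longrightarrow> d > 0 \<Longrightarrow> \<exists>s t. s < x \<and> x < t \<and> t - s < d \<and> Q s t"
    and e: "e > 0"
  obtains P where "finite P" "\<And>s t. (s, t) \<in> P \<Longrightarrow> s < t \<and> {s..t} \<subseteq> U \<and> Q s t"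
    "disjoint_family_on (\<lambda>(s, t). {s<..<t}) P"
    "measure lebesgue E - e \<le> (\<Sum>(s, t)\<in>P. measure lebesgue (E \<inter> {s<..<t}))"
proof -
  define K where "K = {(s, t). s < t \<and> {s..t} \<subseteq> U \<and> Q s t}"
  define c where "c p = (fst p + snd p) / 2" for p :: "real \<times> real"
  define r where "r p = (snd p - fst p) / 2" for p :: "real \<times> real"
  have cb: "cball (c p) (r p) = {fst p..snd p}" for p
  proof -
    have "c p - r p = fst p" "c p + r p = snd p" unfolding c_def r_def by argo+
    then show ?thesis unfolding cball_eq_atLeastAtMost by simp
  qed
  have fine: "\<exists>i. i \<in> K \<and> x \<in> cball (c i) (r i) \<and> r i < d" if x: "x \<in> E" and d: "0 < d" for x d
  proof -
    obtain d' where d': "d' > 0" "cball x d' \<subseteq> U"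
      using x E(2) U by (meson open_contains_cball subsetD)
    obtain s t where st: "s < x" "x < t" "t - s < min d d'" "Q s t"
      using Q[OF x, of "min d d'"] d d'(1) by auto
    have "{s..t} \<subseteq> cball x d'" using st unfolding cball_eq_atLeastAtMost by auto
    then have "(s, t) \<in> K" using st d'(2) unfolding K_def by auto
    moreover have "x \<in> cball (c (s, t)) (r (s, t))" unfolding cb using st by simp
    moreover have "r (s, t) < d" using st unfolding r_def by simp
    ultimately show ?thesis by blast
  qed
  have r_pos: "0 < r i" if "i \<in> K" for i using that unfolding K_def r_def by auto
  obtain C where C: "countable C" "C \<subseteq> K"
    "pairwise (\<lambda>i j. disjnt (cball (c i) (r i)) (cball (c j) (r j))) C"
    "negligible (E - (\<Union>i\<in>C. cball (c i) (r i)))"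
    by (rule Vitali_covering_theorem_cballs[of K r E c, OF r_pos fine])
  define I where "I p = E \<inter> {fst p..snd p}" for p :: "real \<times> real"
  have I_meas: "I p \<in> lmeasurable" for p
    unfolding I_def using E(1) by (intro fmeasurable.Int) auto
  have I_eq: "measure lebesgue (I p) = measure lebesgue (E \<inter> {fst p<..<snd p})" for p
  proof (rule measure_negligible_symdiff[symmetric])
    show "negligible (I p - E \<inter> {fst p<..<snd p} \<union> (E \<inter> {fst p<..<snd p} - I p))"
      by (rule negligible_subset[of "{fst p, snd p}"]) (auto simp: I_def)
    show "I p \<in> lmeasurable" by (rule I_meas)
  qed
  have disj: "I p \<inter> I q = {}" if "p \<in> C" "q \<in> C" "p \<noteq> q" for p q
    using C(3) that unfolding pairwise_def disjnt_def cb I_def by blast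
  have union: "(\<Union>p\<in>C. I p) \<in> lmeasurable"
  proof (rule fmeasurableI2[OF E(1)])
    show "(\<Union>p\<in>C. I p) \<subseteq> E" unfolding I_def by blast
    show "(\<Union>p\<in>C. I p) \<in> sets lebesgue"
      using C(1) I_meas by (intro sets.countable_UN') auto
  qed
  have mE: "measure lebesgue (\<Union>p\<in>C. I p) = measure lebesgue E"
  proof (rule measure_negligible_symdiff[OF E(1)])
    show "negligible (E - (\<Union>p\<in>C. I p) \<union> ((\<Union>p\<in>C. I p) - E))"
      by (rule negligible_subset[OF C(4)]) (auto simp: cb I_def)
  qed
  \<comment> \<open>By countable additivity a finite part of \<open>C\<close> carries all but
    \<open>e\<close> of the measure. The finite case is separate because the enumeration
    \<open>from_nat_into C\<close> is a bijection only for infinite \<open>C\<close>.\<close>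
  have "\<exists>P. finite P \<and> P \<subseteq> C \<and> measure lebesgue E - e \<le> (\<Sum>p\<in>P. measure lebesgue (I p))"
  proof (cases "finite C")
    case True
    have "measure lebesgue (\<Union>p\<in>C. I p) = (\<Sum>p\<in>C. measure lebesgue (I p))"
      using True I_meas disj by (intro measure_UNION') (auto simp: pairwise_def disjnt_def)
    then show ?thesis using True mE e by (intro exI[of _ C]) auto
  next
    case False
    define f where "f = from_nat_into C"
    have f: "bij_betw f UNIV C" unfolding f_def using C(1) False by (rule bij_betw_from_nat_into)
    have rng: "f n \<in> C" for n using f by (auto simp: bij_betw_def)
    have "disjoint_family (\<lambda>n. I (f n))"
      unfolding disjoint_family_on_def using disj rng f by (metis bij_betw_def injD)
    moreover have rng': "range (\<lambda>n. I (f n)) \<subseteq> sets lebesgue"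
      using fmeasurableD[OF I_meas] by blast
    moreover have un: "(\<Union>n. I (f n)) = (\<Union>p\<in>C. I p)" using f unfolding bij_betw_def by blast
    ultimately have "(\<lambda>n. measure lebesgue (I (f n))) sums measure lebesgue (\<Union>n. I (f n))"
      using rng' fmeasurableD2[OF union] by (intro measure_UNION) (auto simp: un)
    then have "(\<lambda>n. \<Sum>i<n. measure lebesgue (I (f i))) \<longlonglongrightarrow> measure lebesgue E"
      unfolding sums_def un mE .
    from LIMSEQ_D[OF this e] obtain n where
      "\<bar>(\<Sum>i<n. measure lebesgue (I (f i))) - measure lebesgue E\<bar> < e" by auto
    moreover have "(\<Sum>i<n. measure lebesgue (I (f i))) = (\<Sum>p\<in>f ` {..<n}. measure lebesgue (I p))"
      using f by (subst sum.reindex) (auto simp: bij_betw_def intro: inj_on_subset)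
    ultimately show ?thesis using rng by (intro exI[of _ "f ` {..<n}"]) auto
  qed
  then obtain P where P: "finite P" "P \<subseteq> C"
    "measure lebesgue E - e \<le> (\<Sum>p\<in>P. measure lebesgue (I p))" by blast
  show ?thesis
  proof (rule that)
    show "finite P" by fact
    show "s < t \<and> {s..t} \<subseteq> U \<and> Q s t" if "(s, t) \<in> P" for s t
      using that P(2) C(2) unfolding K_def by auto
    show "disjoint_family_on (\<lambda>(s, t). {s<..<t}) P"
      unfolding disjoint_family_on_def
    proof (intro ballI impI)
      fix p q assume "p \<in> P" "q \<in> P" "p \<noteq> q"
      then have "{fst p..snd p} \<inter> {fst q..snd q} = {}"
        using C(3) P(2) unfolding pairwise_def disjnt_def cb by blast
      then show "(case p of (s, t) \<Rightarrow> {s<..<t}) \<inter> (case q of (s, t) \<Rightarrow> {s<..<t}) = {}"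
        by (fastforce simp: case_prod_unfold)
    qed
    show "measure lebesgue E - e \<le> (\<Sum>(s, t)\<in>P. measure lebesgue (E \<inter> {s<..<t}))"
      using P(3) by (simp add: I_eq case_prod_unfold)
  qed
qed

text \<open>Only intervals having \<open>x\<close> in their interior are admitted: for continuous \<open>f\<close> this does not
  affect the derivates at \<open>x\<close>, and it makes the set of such \<open>x\<close> a countable intersection of open
  sets.\<close>

definition fine_slope_above :: "(real \<Rightarrow> real) \<Rightarrow> real \<Rightarrow> real \<Rightarrow> bool" where
  "fine_slope_above f q x \<longleftrightarrow>
     (\<forall>d>0. \<exists>s t. s < x \<and> x < t \<and> t - s < d \<and> q * (t - s) < f t - f s)"

lemma borel_fine_slope_above: "{x. fine_slope_above f q x} \<in> sets borel"
proof -
  define W where "W n = (\<Union>(s, t)\<in>{(s, t). t - s < inverse (Suc n) \<and> q * (t - s) < f t - f s}.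
     {s<..<t})" for n
  have "{x. fine_slope_above f q x} = (\<Inter>n. W n)"
  proof (intro equalityI subsetI)
    fix x assume "x \<in> {x. fine_slope_above f q x}"
    then show "x \<in> (\<Inter>n. W n)"
      unfolding fine_slope_above_def W_def
      by clarsimp (metis inverse_positive_iff_positive of_nat_0_less_iff of_nat_Suc zero_less_Suc)
  next
    fix x assume x: "x \<in> (\<Inter>n. W n)"
    show "x \<in> {x. fine_slope_above f q x}"
      unfolding fine_slope_above_def mem_Collect_eq
    proof (intro allI impI)
      fix d :: real assume "d > 0"
      then obtain n where "inverse (Suc n) < d" using reals_Archimedean by blast
      moreover have "x \<in> W n" using x by blast
      ultimately show "\<exists>s t. s < x \<and> x < t \<and> t - s < d \<and> q * (t - s) < f t - f s"
        unfolding W_def by fastforce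
    qed
  qed
  moreover have "open (W n)" for n unfolding W_def by (intro open_UN) auto
  ultimately show ?thesis by auto
qed

text \<open>A Vitali covering by intervals of slope above \<open>r\<close> has total length at least
  the measure of \<open>E\<close> minus \<open>e\<close>, which secures the increment; everything
  else \<open>g\<close> does happens on the gaps \<open>R\<close>. They are returned because
  absolute continuity is later applied to the gaps of many such intervals together.\<close>

lemma increment_ge_fine_slope_above:
  fixes g :: "real \<Rightarrow> real"
  assumes "s < t" and E: "E \<in> lmeasurable" "E \<subseteq> {s<..<t}"
    and fine: "\<And>x. x \<in> E \<Longrightarrow> fine_slope_above g r x"
    and r: "r \<ge> 0" and e: "e > 0"
  obtains R where "finite R" "\<And>u v. (u, v) \<in> R \<Longrightarrow> s \<le> u \<and> u < v \<and> v \<le> t"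
    "disjoint_family_on (\<lambda>(u, v). {u<..<v}) R"
    "(\<Sum>(u, v)\<in>R. v - u) \<le> (t - s) - measure lebesgue E + e"
    "r * (measure lebesgue E - e) + (\<Sum>(u, v)\<in>R. g v - g u) \<le> g t - g s"
proof -
  obtain P where P: "finite P"
    "\<And>u v. (u, v) \<in> P \<Longrightarrow> u < v \<and> {u..v} \<subseteq> {s<..<t} \<and> r * (v - u) < g v - g u"
    "disjoint_family_on (\<lambda>(u, v). {u<..<v}) P"
    "measure lebesgue E - e \<le> (\<Sum>(u, v)\<in>P. measure lebesgue (E \<inter> {u<..<v}))"
    using Vitali_covering_intervals[OF E open_greaterThanLessThan, of "\<lambda>u v. r * (v - u) < g v - g u" e]
      fine e unfolding fine_slope_above_def by metis
  have sub: "s \<le> u \<and> u < v \<and> v \<le> t" if "(u, v) \<in> P" for u v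
    using P(2)[OF that] atLeastAtMost_iff[of u u v] atLeastAtMost_iff[of v u v]
    by (metis greaterThanLessThan_iff less_imp_le order_refl subsetD)
  obtain R where R: "finite R" "\<forall>(u, v)\<in>R. s \<le> u \<and> u < v \<and> v \<le> t"
    "disjoint_family_on (\<lambda>(u, v). {u<..<v}) R"
    and sumR: "\<And>\<phi> :: real \<Rightarrow> real. (\<Sum>(u, v)\<in>P. \<phi> v - \<phi> u) + (\<Sum>(u, v)\<in>R. \<phi> v - \<phi> u) = \<phi> t - \<phi> s"
    using interval_family_complement[OF P(1) less_imp_le[OF \<open>s < t\<close>] _ P(3)] sub by blast
  have "(\<Sum>(u, v)\<in>P. measure lebesgue (E \<inter> {u<..<v})) \<le> (\<Sum>(u, v)\<in>P. v - u)"
  proof (rule sum_mono, clarify)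
    fix u v assume "(u, v) \<in> P"
    then have "u < v" using sub by blast
    have "measure lebesgue (E \<inter> {u<..<v}) \<le> measure lebesgue {u<..<v}"
      using E(1) by (intro measure_mono_fmeasurable) auto
    then show "measure lebesgue (E \<inter> {u<..<v}) \<le> v - u" using \<open>u < v\<close> by simp
  qed
  then have len: "measure lebesgue E - e \<le> (\<Sum>(u, v)\<in>P. v - u)" using P(4) by linarith
  have "r * (measure lebesgue E - e) \<le> r * (\<Sum>(u, v)\<in>P. v - u)"
    using len r by (rule mult_left_mono)
  also have "\<dots> = (\<Sum>(u, v)\<in>P. r * (v - u))"
    by (simp add: sum_distrib_left case_prod_unfold)
  also have "\<dots> \<le> (\<Sum>(u, v)\<in>P. g v - g u)"
    using P(2) by (intro sum_mono) force
  finally have "r * (measure lebesgue E - e) \<le> (\<Sum>(u, v)\<in>P. g v - g u)" .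
  then show ?thesis
    using R len sumR[of "\<lambda>x. x"] sumR[of g] by (intro that[of R]) (auto simp: case_prod_unfold)
qed

section \<open>Basic properties of absolute continuity\<close>

lemma AC_onE:
  assumes "AC_on a b f" "\<epsilon> > 0"
  obtains \<delta> where "\<delta> > 0" "\<And>P. finite P \<Longrightarrow> (\<And>s t. (s, t) \<in> P \<Longrightarrow> a \<le> s \<and> s < t \<and> t \<le> b) \<Longrightarrow>
        disjoint_family_on (\<lambda>(s, t). {s<..<t}) P \<Longrightarrow> (\<Sum>(s, t)\<in>P. t - s) < \<delta> \<Longrightarrow>
        \<bar>\<Sum>(s, t)\<in>P. f t - f s\<bar> < \<epsilon>"
proof -
  obtain \<delta> where d: "\<delta> > 0" "\<forall>P. finite P \<and> (\<forall>(s, t)\<in>P. a \<le> s \<and> s < t \<and> t \<le> b) \<and>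
        disjoint_family_on (\<lambda>(s, t). {s<..<t}) P \<and> (\<Sum>(s, t)\<in>P. t - s) < \<delta>
        \<longrightarrow> (\<Sum>(s, t)\<in>P. \<bar>f t - f s\<bar>) < \<epsilon>"
    using assms unfolding AC_on_def by meson
  show ?thesis
  proof (rule that[OF d(1)])
    fix P assume "finite P" "\<And>s t. (s, t) \<in> P \<Longrightarrow> a \<le> s \<and> s < t \<and> t \<le> b"
      "disjoint_family_on (\<lambda>(s, t). {s<..<t}) P" "(\<Sum>(s, t)\<in>P. t - s) < \<delta>"
    then have "(\<Sum>(s, t)\<in>P. \<bar>f t - f s\<bar>) < \<epsilon>" using d(2) by blast
    moreover have "\<bar>\<Sum>(s, t)\<in>P. f t - f s\<bar> \<le> (\<Sum>(s, t)\<in>P. \<bar>f t - f s\<bar>)"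
      using sum_abs[of "\<lambda>(s, t). f t - f s" P] by (simp add: case_prod_unfold)
    ultimately show "\<bar>\<Sum>(s, t)\<in>P. f t - f s\<bar> < \<epsilon>" by linarith
  qed
qed

lemma AC_on_lincomb:
  assumes "AC_on a b f" "AC_on a b g"
  shows "AC_on a b (\<lambda>x. f x + c * g x)"
  unfolding AC_on_def
proof (intro allI impI)
  fix \<epsilon> :: real assume e: "\<epsilon> > 0"
  \<comment> \<open>Chosen so that the two contributions \<epsilon>' and
    \<open>\<bar>c\<bar> * \<epsilon>'\<close> add up to half of \<epsilon>; the summand 1 covers
    \<open>c = 0\<close>.\<close>
  define \<epsilon>' where "\<epsilon>' = \<epsilon> / (2 * (1 + \<bar>c\<bar>))"
  have "\<epsilon> / (2 * k) > 0 \<and> k * (\<epsilon> / (2 * k)) = \<epsilon> / 2" if "k > 0" for k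
    using e that by simp
  from this[of "1 + \<bar>c\<bar>"] have "\<epsilon>' > 0" "(1 + \<bar>c\<bar>) * \<epsilon>' = \<epsilon> / 2"
    unfolding \<epsilon>'_def by linarith+
  then have e': "\<epsilon>' > 0" "\<epsilon>' + \<bar>c\<bar> * \<epsilon>' = \<epsilon> / 2" by (simp_all add: distrib_right)
  let ?ok = "\<lambda>P \<delta>. finite P \<and> (\<forall>(s, t)\<in>P. a \<le> s \<and> s < t \<and> t \<le> b) \<and>
        disjoint_family_on (\<lambda>(s, t). {s<..<t}) P \<and> (\<Sum>(s, t)\<in>P. t - s) < \<delta>"
  obtain d1 where d1: "d1 > 0" "\<And>P. ?ok P d1 \<Longrightarrow> (\<Sum>(s, t)\<in>P. \<bar>f t - f s\<bar>) < \<epsilon>'"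
    using assms(1) e'(1) unfolding AC_on_def by meson
  obtain d2 where d2: "d2 > 0" "\<And>P. ?ok P d2 \<Longrightarrow> (\<Sum>(s, t)\<in>P. \<bar>g t - g s\<bar>) < \<epsilon>'"
    using assms(2) e'(1) unfolding AC_on_def by meson
  show "\<exists>\<delta>>0. \<forall>P. ?ok P \<delta> \<longrightarrow>
      (\<Sum>(s, t)\<in>P. \<bar>f t + c * g t - (f s + c * g s)\<bar>) < \<epsilon>"
  proof (rule exI[of _ "min d1 d2"], intro conjI allI impI)
    show "min d1 d2 > 0" using d1 d2 by simp
    fix P assume P: "?ok P (min d1 d2)"
    have "(\<Sum>(s, t)\<in>P. \<bar>f t + c * g t - (f s + c * g s)\<bar>)
          \<le> (\<Sum>(s, t)\<in>P. \<bar>f t - f s\<bar> + \<bar>c\<bar> * \<bar>g t - g s\<bar>)"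
    proof (rule sum_mono, clarify)
      fix s t
      have "f t + c * g t - (f s + c * g s) = (f t - f s) + c * (g t - g s)" by (simp add: algebra_simps)
      then show "\<bar>f t + c * g t - (f s + c * g s)\<bar> \<le> \<bar>f t - f s\<bar> + \<bar>c\<bar> * \<bar>g t - g s\<bar>"
        by (metis abs_mult abs_triangle_ineq)
    qed
    also have "\<dots> = (\<Sum>(s, t)\<in>P. \<bar>f t - f s\<bar>) + \<bar>c\<bar> * (\<Sum>(s, t)\<in>P. \<bar>g t - g s\<bar>)"
      by (simp add: sum.distrib sum_distrib_left case_prod_unfold)
    also have "\<dots> \<le> \<epsilon>' + \<bar>c\<bar> * \<epsilon>'"
      using d1(2)[of P] d2(2)[of P] P by (intro add_mono mult_left_mono) auto
    also have "\<dots> < \<epsilon>" using e' e by simp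
    finally show "(\<Sum>(s, t)\<in>P. \<bar>f t + c * g t - (f s + c * g s)\<bar>) < \<epsilon>" .
  qed
qed

lemma Lipschitz_imp_AC_on:
  assumes "\<And>s t. a \<le> s \<Longrightarrow> s \<le> t \<Longrightarrow> t \<le> b \<Longrightarrow> \<bar>f t - f s\<bar> \<le> M * (t - s)"
  shows "AC_on a b f"
  unfolding AC_on_def
proof (intro allI impI)
  fix \<epsilon> :: real assume e: "\<epsilon> > 0"
  have pos: "0 < 1 + \<bar>M\<bar>" by linarith
  show "\<exists>\<delta>>0. \<forall>P. finite P \<and> (\<forall>(s, t)\<in>P. a \<le> s \<and> s < t \<and> t \<le> b) \<and>
        disjoint_family_on (\<lambda>(s, t). {s<..<t}) P \<and> (\<Sum>(s, t)\<in>P. t - s) < \<delta>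
        \<longrightarrow> (\<Sum>(s, t)\<in>P. \<bar>f t - f s\<bar>) < \<epsilon>"
  proof (rule exI[of _ "\<epsilon> / (1 + \<bar>M\<bar>)"], intro conjI allI impI)
    show "\<epsilon> / (1 + \<bar>M\<bar>) > 0" using e pos by simp
    fix P assume P: "finite P \<and> (\<forall>(s, t)\<in>P. a \<le> s \<and> s < t \<and> t \<le> b) \<and>
        disjoint_family_on (\<lambda>(s, t). {s<..<t}) P \<and> (\<Sum>(s, t)\<in>P. t - s) < \<epsilon> / (1 + \<bar>M\<bar>)"
    have "(\<Sum>(s, t)\<in>P. \<bar>f t - f s\<bar>) \<le> (\<Sum>(s, t)\<in>P. (1 + \<bar>M\<bar>) * (t - s))"
    proof (rule sum_mono, clarify)
      fix s t assume "(s, t) \<in> P"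
      then have st: "a \<le> s" "s \<le> t" "t \<le> b" using P by auto
      have "\<bar>f t - f s\<bar> \<le> M * (t - s)" using assms st by blast
      also have "\<dots> \<le> (1 + \<bar>M\<bar>) * (t - s)" using st by (intro mult_right_mono) auto
      finally show "\<bar>f t - f s\<bar> \<le> (1 + \<bar>M\<bar>) * (t - s)" .
    qed
    also have "\<dots> = (1 + \<bar>M\<bar>) * (\<Sum>(s, t)\<in>P. t - s)"
      by (simp add: sum_distrib_left case_prod_unfold)
    also have "\<dots> < \<epsilon>" using P pos by (simp add: field_simps)
    finally show "(\<Sum>(s, t)\<in>P. \<bar>f t - f s\<bar>) < \<epsilon>" .
  qed
qed

lemma AC_on_imp_continuous_on:
  assumes "AC_on a b f"
  shows "continuous_on {a..b} f"
  unfolding continuous_on_iff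
proof (intro ballI allI impI)
  fix x e :: real assume x: "x \<in> {a..b}" and e: "e > 0"
  obtain \<delta> where d: "\<delta> > 0" "\<And>P. finite P \<Longrightarrow> (\<And>s t. (s, t) \<in> P \<Longrightarrow> a \<le> s \<and> s < t \<and> t \<le> b) \<Longrightarrow>
        disjoint_family_on (\<lambda>(s, t). {s<..<t}) P \<Longrightarrow> (\<Sum>(s, t)\<in>P. t - s) < \<delta> \<Longrightarrow>
        \<bar>\<Sum>(s, t)\<in>P. f t - f s\<bar> < e"
    using AC_onE[OF assms e] by metis
  have *: "\<bar>f t - f s\<bar> < e" if "a \<le> s" "s < t" "t \<le> b" "t - s < \<delta>" for s t
    using d(2)[of "{(s, t)}"] that by (auto simp: disjoint_family_on_def)
  show "\<exists>d>0. \<forall>x'\<in>{a..b}. dist x' x < d \<longrightarrow> dist (f x') (f x) < e"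
  proof (rule exI[of _ \<delta>], intro conjI ballI impI)
    fix x' assume "x' \<in> {a..b}" "dist x' x < \<delta>"
    then show "dist (f x') (f x) < e"
      using *[of x x'] *[of x' x] x e unfolding dist_real_def
      by (cases x x' rule: linorder_cases) (auto simp: abs_minus_commute)
  qed (rule d(1))
qed

section \<open>Points with slopes on both sides of a gap\<close>

lemma fine_slope_above_minus:
  "fine_slope_above (\<lambda>x. - f x) q x \<longleftrightarrow>
     (\<forall>d>0. \<exists>s t. s < x \<and> x < t \<and> t - s < d \<and> f t - f s < - q * (t - s))"
proof -
  have "(q * (t - s) < - f t - - f s) = (f t - f s < - q * (t - s))" for s t by auto
  then show ?thesis unfolding fine_slope_above_def by simp
qed

text \<open>Adding a linear function moves two thresholds \<open>p < q\<close> to the symmetric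
  position \<open>- r\<close>, \<open>r\<close>, the case to which negligibility is reduced.\<close>

lemma fine_slope_above_shift:
  "fine_slope_above (\<lambda>x. f x + c * x) q x \<longleftrightarrow> fine_slope_above f (q - c) x"
proof -
  have "(q * (t - s) < f t + c * t - (f s + c * s)) = ((q - c) * (t - s) < f t - f s)" for s t
    by (auto simp: algebra_simps)
  then show ?thesis unfolding fine_slope_above_def by simp
qed

text \<open>Two Vitali coverings of \<open>E\<close> are nested: a finite family of intervals of slope below \<open>- r\<close>, and
  inside each of its members a finite family of intervals of slope above \<open>r\<close>. Both nearly exhaust
  \<open>E\<close>, so the intervals left over between them have small total length, but \<open>g\<close> changes by at
  least \<open>r\<close> times the measure of \<open>E\<close> on them.\<close>

lemma AC_on_fine_slopes_negligible:
  fixes g :: "real \<Rightarrow> real"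
  assumes g: "AC_on a b g" and E: "E \<in> lmeasurable" "E \<subseteq> {a<..<b}" and r: "r > 0"
    and up: "\<And>x. x \<in> E \<Longrightarrow> fine_slope_above g r x"
    and down: "\<And>x. x \<in> E \<Longrightarrow> fine_slope_above (\<lambda>x. - g x) r x"
  shows "measure lebesgue E = 0"
proof (rule ccontr)
  define m where "m = measure lebesgue E"
  assume "measure lebesgue E \<noteq> 0"
  then have m: "m > 0" unfolding m_def using measure_nonneg[of lebesgue E] by linarith
  obtain \<delta> where d: "\<delta> > 0" "\<And>P. finite P \<Longrightarrow> (\<And>s t. (s, t) \<in> P \<Longrightarrow> a \<le> s \<and> s < t \<and> t \<le> b) \<Longrightarrow>
        disjoint_family_on (\<lambda>(s, t). {s<..<t}) P \<Longrightarrow> (\<Sum>(s, t)\<in>P. t - s) < \<delta> \<Longrightarrow>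
        \<bar>\<Sum>(s, t)\<in>P. g t - g s\<bar> < r * m"
    using AC_onE[OF g mult_pos_pos[OF r m]] by metis
  \<comment> \<open>The leftover intervals will have total length at most (m + e) - (m - e) + e = 3
    e, and \<open>g\<close> will change on them by at most r e - 2 r (m - e) = - r m + r (3 e - m).
    Hence the two requirements 3 e < \<delta> and 3 e \<le> m.\<close>
  define e where "e = min (\<delta> / 4) (m / 3)"
  have e: "e > 0" "3 * e < \<delta>" "3 * e \<le> m" unfolding e_def using d(1) m by auto
  \<comment> \<open>An open superset of \<open>E\<close> with little excess measure: confining the
    outer intervals to it caps their total length at m + e.\<close>
  obtain T where T: "open T" "E \<subseteq> T" "T - E \<in> lmeasurable"
    and "emeasure lebesgue (T - E) < ennreal e"
    using sets_lebesgue_outer_open[OF fmeasurableD[OF E(1)] e(1)] by metis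
  then have T_less: "measure lebesgue (T - E) < e"
    using e(1) by (simp add: emeasure_eq_measure2 ennreal_less_iff)
  define U where "U = T \<inter> {a<..<b}"
  have U: "open U" "E \<subseteq> U" "U \<subseteq> {a<..<b}" unfolding U_def using T E(2) by auto
  have UE: "U - E = (T - E) \<inter> {a<..<b}" unfolding U_def by auto
  have U_meas: "U \<in> lmeasurable"
  proof (rule lmeasurable_open)
    show "bounded U" using U(3) by (intro bounded_subset[OF bounded_closed_interval[of a b]]) auto
  qed (rule U(1))
  have mU: "measure lebesgue U \<le> m + e"
  proof -
    have "measure lebesgue (U - E) \<le> measure lebesgue (T - E)"
      by (rule measure_mono_fmeasurable) (use T U_meas E UE in auto)
    moreover have "measure lebesgue U = measure lebesgue E + measure lebesgue (U - E)"
      using measure_Un2[OF E(1) U_meas] U(2) by (simp add: Un_absorb1)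
    ultimately show ?thesis using T_less unfolding m_def by linarith
  qed
  obtain P where P: "finite P"
    "\<And>u v. (u, v) \<in> P \<Longrightarrow> u < v \<and> {u..v} \<subseteq> U \<and> g v - g u < - r * (v - u)"
    "disjoint_family_on (\<lambda>(u, v). {u<..<v}) P"
    "m - e \<le> (\<Sum>(u, v)\<in>P. measure lebesgue (E \<inter> {u<..<v}))"
    using Vitali_covering_intervals[OF E(1) U(2,1), of "\<lambda>u v. g v - g u < - r * (v - u)" e]
      down e(1) unfolding fine_slope_above_minus m_def by metis
  have Pab: "a < u \<and> u < v \<and> v < b" if "(u, v) \<in> P" for u v
  proof -
    have uv: "u < v" "{u..v} \<subseteq> U" using P(2)[OF that] by blast+
    then have "u \<in> U" "v \<in> U" by auto
    then show ?thesis using uv(1) U(3) by auto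
  qed
  \<comment> \<open>Each inner covering may lose \<open>e / n\<close>, so that all of them together
    lose at most \<open>e\<close>; the 1 keeps \<open>n\<close> positive when \<open>P\<close> is
    empty.\<close>
  define n where "n = real (card P) + 1"
  have n: "n > 0" "real (card P) * (e / n) \<le> e" unfolding n_def using e(1) by (auto simp: field_simps)
  define \<mu> where "\<mu> p = measure lebesgue (E \<inter> {fst p<..<snd p})" for p
  have "\<exists>R. finite R \<and> (\<forall>(u, v)\<in>R. fst p \<le> u \<and> u < v \<and> v \<le> snd p) \<and>
    disjoint_family_on (\<lambda>(u, v). {u<..<v}) R \<and>
    (\<Sum>(u, v)\<in>R. v - u) \<le> (snd p - fst p) - \<mu> p + e / n \<and>
    r * (\<mu> p - e / n) + (\<Sum>(u, v)\<in>R. g v - g u) \<le> g (snd p) - g (fst p)" if "p \<in> P" for p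
  proof -
    have "fst p < snd p" using Pab[of "fst p" "snd p"] that by simp
    moreover have "E \<inter> {fst p<..<snd p} \<in> lmeasurable" using E(1) by (intro fmeasurable.Int) auto
    moreover have "fine_slope_above g r x" if "x \<in> E \<inter> {fst p<..<snd p}" for x
      using up that by blast
    ultimately obtain R where "finite R" "\<And>u v. (u, v) \<in> R \<Longrightarrow> fst p \<le> u \<and> u < v \<and> v \<le> snd p"
      "disjoint_family_on (\<lambda>(u, v). {u<..<v}) R"
      "(\<Sum>(u, v)\<in>R. v - u) \<le> (snd p - fst p) - \<mu> p + e / n"
      "r * (\<mu> p - e / n) + (\<Sum>(u, v)\<in>R. g v - g u) \<le> g (snd p) - g (fst p)"
      using increment_ge_fine_slope_above[of "fst p" "snd p" "E \<inter> {fst p<..<snd p}" g r "e / n"]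
        r e(1) n(1) unfolding \<mu>_def by auto
    then show ?thesis by (intro exI[of _ R]) auto
  qed
  then have "\<forall>p\<in>P. \<exists>R. finite R \<and> (\<forall>(u, v)\<in>R. fst p \<le> u \<and> u < v \<and> v \<le> snd p) \<and>
    disjoint_family_on (\<lambda>(u, v). {u<..<v}) R \<and>
    (\<Sum>(u, v)\<in>R. v - u) \<le> (snd p - fst p) - \<mu> p + e / n \<and>
    r * (\<mu> p - e / n) + (\<Sum>(u, v)\<in>R. g v - g u) \<le> g (snd p) - g (fst p)" by blast
  from bchoice[OF this] obtain R where R0:
    "\<forall>p\<in>P. finite (R p) \<and> (\<forall>(u, v)\<in>R p. fst p \<le> u \<and> u < v \<and> v \<le> snd p) \<and>
    disjoint_family_on (\<lambda>(u, v). {u<..<v}) (R p) \<and>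
    (\<Sum>(u, v)\<in>R p. v - u) \<le> (snd p - fst p) - \<mu> p + e / n \<and>
    r * (\<mu> p - e / n) + (\<Sum>(u, v)\<in>R p. g v - g u) \<le> g (snd p) - g (fst p)" by blast
  have R: "\<And>p. p \<in> P \<Longrightarrow> finite (R p)"
    "\<And>p u v. p \<in> P \<Longrightarrow> (u, v) \<in> R p \<Longrightarrow> fst p \<le> u \<and> u < v \<and> v \<le> snd p"
    "\<And>p. p \<in> P \<Longrightarrow> disjoint_family_on (\<lambda>(u, v). {u<..<v}) (R p)"
    "\<And>p. p \<in> P \<Longrightarrow> (\<Sum>(u, v)\<in>R p. v - u) \<le> (snd p - fst p) - \<mu> p + e / n"
    "\<And>p. p \<in> P \<Longrightarrow> r * (\<mu> p - e / n) + (\<Sum>(u, v)\<in>R p. g v - g u) \<le> g (snd p) - g (fst p)"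
    using R0 by blast+
  define S where "S = (\<Union>p\<in>P. R p)"
  have cross: "{u<..<v} \<inter> {u'<..<v'} = {}"
    if "p \<in> P" "q \<in> P" "p \<noteq> q" "(u, v) \<in> R p" "(u', v') \<in> R q" for p q u v u' v'
  proof -
    have "{fst p<..<snd p} \<inter> {fst q<..<snd q} = {}"
      using P(3) that(1-3) unfolding disjoint_family_on_def case_prod_unfold by blast
    moreover have "{u<..<v} \<subseteq> {fst p<..<snd p}" "{u'<..<v'} \<subseteq> {fst q<..<snd q}"
      using R(2)[OF that(1,4)] R(2)[OF that(2,5)] by auto
    ultimately show ?thesis by blast
  qed
  have sumS: "(\<Sum>(u, v)\<in>S. \<phi> u v) = (\<Sum>p\<in>P. \<Sum>(u, v)\<in>R p. \<phi> u v)"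
    for \<phi> :: "real \<Rightarrow> real \<Rightarrow> real"
    unfolding S_def
  proof (rule sum.UNION_disjoint)
    show "\<forall>p\<in>P. \<forall>q\<in>P. p \<noteq> q \<longrightarrow> R p \<inter> R q = {}"
    proof (intro ballI impI, rule ccontr)
      fix p q assume pq: "p \<in> P" "q \<in> P" "p \<noteq> q" "R p \<inter> R q \<noteq> {}"
      then obtain u v where uv: "(u, v) \<in> R p" "(u, v) \<in> R q" by auto
      have "{u<..<v} = {}" using cross[OF pq(1-3) uv] by simp
      moreover have "u < v" using R(2)[OF pq(1) uv(1)] by blast
      ultimately show False by simp
    qed
  qed (use P(1) R(1) in auto)
  have "disjoint_family_on (\<lambda>(u, v). {u<..<v}) S"
    unfolding disjoint_family_on_def
  proof (intro ballI impI)
    fix x y assume xy: "x \<in> S" "y \<in> S" "x \<noteq> y"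
    then obtain p q where pq: "p \<in> P" "x \<in> R p" "q \<in> P" "y \<in> R q" unfolding S_def by blast
    show "(case x of (u, v) \<Rightarrow> {u<..<v}) \<inter> (case y of (u, v) \<Rightarrow> {u<..<v}) = {}"
    proof (cases "p = q")
      case True
      then show ?thesis using R(3)[OF pq(1)] pq xy(3) unfolding disjoint_family_on_def by blast
    next
      case False
      then show ?thesis using cross[OF pq(1,3) False, of "fst x" "snd x" "fst y" "snd y"] pq
        by (simp add: case_prod_unfold)
    qed
  qed
  moreover have "finite S" unfolding S_def using P(1) R(1) by blast
  moreover have "a \<le> u \<and> u < v \<and> v \<le> b" if uv: "(u, v) \<in> S" for u v
  proof -
    obtain p where p: "p \<in> P" "(u, v) \<in> R p" using uv unfolding S_def by blast
    show ?thesis using R(2)[OF p] Pab[of "fst p" "snd p"] p(1) by simp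
  qed
  moreover have "(\<Sum>(u, v)\<in>S. v - u) < \<delta>"
  proof -
    have "(\<Sum>(u, v)\<in>S. v - u) \<le> (\<Sum>p\<in>P. (snd p - fst p) - \<mu> p + e / n)"
      unfolding sumS using R(4) by (rule sum_mono)
    also have "\<dots> = (\<Sum>p\<in>P. snd p - fst p) - (\<Sum>p\<in>P. \<mu> p) + real (card P) * (e / n)"
      by (simp add: sum.distrib sum_subtractf)
    also have "(\<Sum>p\<in>P. snd p - fst p) = (\<Sum>p\<in>P. measure lebesgue {fst p<..<snd p})"
      using Pab by (intro sum.cong) force+
    also have "\<dots> = measure lebesgue (\<Union>p\<in>P. {fst p<..<snd p})"
      using P(1,3) unfolding disjoint_family_on_def
      by (intro measure_UNION'[symmetric]) (auto simp: pairwise_def disjnt_def case_prod_unfold)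
    also have "\<dots> \<le> measure lebesgue U"
    proof (rule measure_mono_fmeasurable)
      show "(\<Union>p\<in>P. {fst p<..<snd p}) \<subseteq> U" using P(2) by force
      show "(\<Union>p\<in>P. {fst p<..<snd p}) \<in> sets lebesgue"
        using P(1) by (intro sets.finite_UN) auto
    qed (rule U_meas)
    finally show ?thesis using mU P(4) n(2) e(2) unfolding \<mu>_def case_prod_unfold by linarith
  qed
  ultimately have "\<bar>\<Sum>(u, v)\<in>S. g v - g u\<bar> < r * m" by (intro d(2))
  \<comment> \<open>Over an outer interval \<open>p\<close>, \<open>g\<close> falls by more than r
    \<mu>(p), although the inner covering makes it rise by at least r (\<mu>(p) - e / n). The gaps
    must account for both, a fall of almost 2 r \<mu>(p).\<close>
  moreover have "(\<Sum>(u, v)\<in>S. g v - g u) \<le> - (r * m)"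
  proof -
    have "(\<Sum>(u, v)\<in>S. g v - g u) \<le> (\<Sum>p\<in>P. (g (snd p) - g (fst p)) - r * (\<mu> p - e / n))"
      unfolding sumS using R(5) by (intro sum_mono) fastforce
    also have "\<dots> \<le> (\<Sum>p\<in>P. - r * \<mu> p - r * (\<mu> p - e / n))"
    proof (rule sum_mono)
      fix p assume p: "p \<in> P"
      then have "fst p < snd p" using Pab[of "fst p" "snd p"] by simp
      have "\<mu> p \<le> measure lebesgue {fst p<..<snd p}"
        unfolding \<mu>_def using E(1) by (intro measure_mono_fmeasurable) auto
      then have "r * \<mu> p \<le> r * (snd p - fst p)" using r \<open>fst p < snd p\<close> by simp
      moreover have "g (snd p) - g (fst p) < - r * (snd p - fst p)"
        using P(2)[of "fst p" "snd p"] p by simp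
      ultimately show "(g (snd p) - g (fst p)) - r * (\<mu> p - e / n) \<le> - r * \<mu> p - r * (\<mu> p - e / n)"
        by linarith
    qed
    also have "\<dots> = (\<Sum>p\<in>P. r * (e / n) - 2 * (r * \<mu> p))"
      by (intro sum.cong) (auto simp: algebra_simps)
    also have "\<dots> = r * (real (card P) * (e / n)) - 2 * (r * (\<Sum>p\<in>P. \<mu> p))"
      by (simp add: sum_subtractf sum_distrib_left)
    also have "\<dots> \<le> r * e - 2 * (r * (m - e))"
      using P(4) n(2) r unfolding \<mu>_def case_prod_unfold
      by (intro diff_mono mult_left_mono) auto
    also have "\<dots> = - (r * m) + r * (3 * e - m)" by (simp add: algebra_simps)
    also have "\<dots> \<le> - (r * m)" using e(3) r by (simp add: mult_le_0_iff)
    finally show ?thesis .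
  qed
  ultimately show False using r m by (simp add: abs_if split: if_splits)
qed

section \<open>Points of unbounded slope, and differentiability almost everywhere\<close>

lemma sets_fine_slope_above: "{x. fine_slope_above f q x} \<in> sets lebesgue"
  using borel_fine_slope_above sets_completionI_sets by (metis sets_lborel)

text \<open>Inside an interval shorter than \<delta> every disjoint family is short enough for
  absolute continuity, so increments over it stay below 1; steep intervals covering a set of
  positive measure would exceed this. Countably many such short intervals exhaust the
  domain.\<close>

lemma AC_on_unbounded_slope_negligible:
  fixes f :: "real \<Rightarrow> real"
  assumes f: "AC_on a b f"
  shows "negligible ({a<..<b} \<inter> {x. \<forall>n::nat. fine_slope_above f (real n) x})"
proof -
  define I where "I = {x. \<forall>n::nat. fine_slope_above f (real n) x}"
  have I_meas: "I \<in> sets lebesgue"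
  proof -
    have "I = (\<Inter>n. {x. fine_slope_above f (real n) x})" unfolding I_def by auto
    then show ?thesis using sets_fine_slope_above by auto
  qed
  obtain \<delta> where d: "\<delta> > 0" "\<And>P. finite P \<Longrightarrow> (\<And>s t. (s, t) \<in> P \<Longrightarrow> a \<le> s \<and> s < t \<and> t \<le> b) \<Longrightarrow>
        disjoint_family_on (\<lambda>(s, t). {s<..<t}) P \<Longrightarrow> (\<Sum>(s, t)\<in>P. t - s) < \<delta> \<Longrightarrow>
        \<bar>\<Sum>(s, t)\<in>P. f t - f s\<bar> < 1"
    using AC_onE[OF f, of 1] by (metis zero_less_one)
  have small: "negligible (I \<inter> {c<..<e})" if ce: "a \<le> c" "c < e" "e \<le> b" "e - c < \<delta>" for c e
  proof -
    define E where "E = I \<inter> {c<..<e}"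
    define m where "m = measure lebesgue E"
    have "E = {c<..<e} \<inter> I" unfolding E_def by blast
    then have E: "E \<in> lmeasurable" "E \<subseteq> {c<..<e}"
      using fmeasurable_Int_fmeasurable[of "{c<..<e}" lebesgue I] I_meas by auto
    have "m = 0"
    proof (rule ccontr)
      assume "m \<noteq> 0"
      then have m: "m > 0" unfolding m_def using measure_nonneg[of lebesgue E] by linarith
      \<comment> \<open>Intervals of slope above \<open>n\<close> and total length at least
        \<open>m / 2\<close> raise \<open>f\<close> by at least n m / 2, which is more than
        1.\<close>
      obtain n :: nat where n: "2 / m < real n" using reals_Archimedean2 by blast
      have fine: "\<exists>s t. s < x \<and> x < t \<and> t - s < d \<and> real n * (t - s) < f t - f s"
        if "x \<in> E" "d > 0" for x d
        using that unfolding E_def I_def fine_slope_above_def by blast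
      obtain P where P: "finite P"
        "\<And>u v. (u, v) \<in> P \<Longrightarrow> u < v \<and> {u..v} \<subseteq> {c<..<e} \<and> real n * (v - u) < f v - f u"
        "disjoint_family_on (\<lambda>(u, v). {u<..<v}) P"
        "m - m / 2 \<le> (\<Sum>(u, v)\<in>P. measure lebesgue (E \<inter> {u<..<v}))"
        using Vitali_covering_intervals[OF E open_greaterThanLessThan fine half_gt_zero[OF m],
            folded m_def] by blast
      have sub: "c \<le> u \<and> u < v \<and> v \<le> e" if "(u, v) \<in> P" for u v
        using P(2)[OF that] atLeastAtMost_iff[of u u v] atLeastAtMost_iff[of v u v]
        by (metis greaterThanLessThan_iff less_imp_le order_refl subsetD)
      obtain R where R: "\<forall>(u, v)\<in>R. c \<le> u \<and> u < v \<and> v \<le> e"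
        "\<And>\<phi> :: real \<Rightarrow> real. (\<Sum>(u, v)\<in>P. \<phi> v - \<phi> u) + (\<Sum>(u, v)\<in>R. \<phi> v - \<phi> u) = \<phi> e - \<phi> c"
        using interval_family_complement[OF P(1) less_imp_le[OF \<open>c < e\<close>] _ P(3)] sub by blast
      have "0 \<le> (\<Sum>(u, v)\<in>R. v - u)" using R(1) by (intro sum_nonneg) auto
      then have "(\<Sum>(u, v)\<in>P. v - u) < \<delta>" using R(2)[of "\<lambda>x. x"] ce(4) by simp
      then have "\<bar>\<Sum>(u, v)\<in>P. f v - f u\<bar> < 1"
        using sub ce by (intro d(2) P) fastforce+
      moreover have "1 \<le> (\<Sum>(u, v)\<in>P. f v - f u)"
      proof -
        have "(\<Sum>(u, v)\<in>P. measure lebesgue (E \<inter> {u<..<v})) \<le> (\<Sum>(u, v)\<in>P. v - u)"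
        proof (rule sum_mono, clarify)
          fix u v assume "(u, v) \<in> P"
          then have "u < v" using sub by blast
          have "measure lebesgue (E \<inter> {u<..<v}) \<le> measure lebesgue {u<..<v}"
            using E(1) by (intro measure_mono_fmeasurable) auto
          then show "measure lebesgue (E \<inter> {u<..<v}) \<le> v - u" using \<open>u < v\<close> by simp
        qed
        then have "m / 2 \<le> (\<Sum>(u, v)\<in>P. v - u)" using P(4) by linarith
        then have "real n * (m / 2) \<le> real n * (\<Sum>(u, v)\<in>P. v - u)" by (rule mult_left_mono) simp
        also have "\<dots> = (\<Sum>(u, v)\<in>P. real n * (v - u))"
          by (simp add: sum_distrib_left case_prod_unfold)
        also have "\<dots> \<le> (\<Sum>(u, v)\<in>P. f v - f u)" using P(2) by (intro sum_mono) force
        finally show ?thesis using n m by (simp add: field_simps)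
      qed
      ultimately show False by linarith
    qed
    then show ?thesis using E(1) unfolding m_def E_def by (simp add: negligible_iff_measure)
  qed
  \<comment> \<open>Rational centres make the cover countable, and the radius \<delta>/3 keeps each
    interval at length at most 2\<delta>/3, below \<delta>.\<close>
  have "({a<..<b} \<inter> I) \<subseteq> (\<Union>q\<in>\<rat>. I \<inter> {max a (q - \<delta> / 3)<..<min b (q + \<delta> / 3)})"
  proof
    fix x assume x: "x \<in> {a<..<b} \<inter> I"
    obtain q where "q \<in> \<rat>" "x < q" "q < x + \<delta> / 3"
      using Rats_dense_in_real[of x "x + \<delta> / 3"] d(1) by auto
    then show "x \<in> (\<Union>q\<in>\<rat>. I \<inter> {max a (q - \<delta> / 3)<..<min b (q + \<delta> / 3)})"
      using x d(1) by (intro UN_I[of q]) auto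
  qed
  moreover have "negligible (\<Union>q\<in>\<rat>. I \<inter> {max a (q - \<delta> / 3)<..<min b (q + \<delta> / 3)})"
  proof (rule negligible_countable_Union, goal_cases)
    case 1
    show ?case using countable_rat by (rule countable_image)
  next
    case (2 S)
    then obtain q where S: "S = I \<inter> {max a (q - \<delta> / 3)<..<min b (q + \<delta> / 3)}" by blast
    show ?case
    proof (cases "max a (q - \<delta> / 3) < min b (q + \<delta> / 3)")
      case True
      then show ?thesis unfolding S using d(1) by (intro small) auto
    next
      case False
      then have "{max a (q - \<delta> / 3)<..<min b (q + \<delta> / 3)} = {}"
        by (intro greaterThanLessThan_empty) (simp only: not_less)
      then show ?thesis unfolding S by (simp only: Int_empty_right negligible_empty)
    qed
  qed
  ultimately show ?thesis unfolding I_def[symmetric] using negligible_subset by blast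
qed

text \<open>At an interior point, differentiability can fail only through slopes of short intervals
  that are unbounded above, unbounded below, or recurrently below \<open>p\<close> and above
  \<open>q\<close> for some rationals \<open>p < q\<close>. These are countably many null
  sets.\<close>

theorem AC_on_differentiable_ae:
  fixes f :: "real \<Rightarrow> real"
  assumes f: "AC_on a b f"
  obtains N where "negligible N" "\<And>x. x \<in> {a..b} - N \<Longrightarrow> f field_differentiable (at x)"
proof -
  define B where "B p q = {a<..<b} \<inter> {x. fine_slope_above f q x} \<inter> {x. fine_slope_above (\<lambda>x. - f x) (- p) x}"
    for p q
  have minus: "AC_on a b (\<lambda>x. - f x)"
    using AC_on_lincomb[OF _ f, of "\<lambda>x. 0" "-1"] Lipschitz_imp_AC_on[of a b "\<lambda>x. 0" 0] by simp
  have B_negl: "negligible (B p q)" if "p < q" for p q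
  proof -
    \<comment> \<open>Subtracting the mean slope turns the thresholds \<open>p\<close> and
      \<open>q\<close> into \<open>- r\<close> and \<open>r\<close>.\<close>
    define c where "c = - (p + q) / 2"
    define r where "r = (q - p) / 2"
    have "AC_on a b (\<lambda>x. f x + c * x)"
      by (rule AC_on_lincomb[OF f Lipschitz_imp_AC_on[of _ _ _ 1]]) simp
    moreover have meas: "B p q \<in> lmeasurable"
    proof -
      have "{x. fine_slope_above f q x} \<inter> {x. fine_slope_above (\<lambda>x. - f x) (- p) x} \<in> sets lebesgue"
        using sets_fine_slope_above by blast
      then show ?thesis
        unfolding B_def Int_assoc by (intro fmeasurable_Int_fmeasurable) auto
    qed
    moreover have "B p q \<subseteq> {a<..<b}" unfolding B_def by auto
    moreover have "r > 0" using that unfolding r_def by simp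
    moreover have "fine_slope_above (\<lambda>x. f x + c * x) r x" if "x \<in> B p q" for x
    proof -
      have "r - c = q" unfolding r_def c_def by argo
      then show ?thesis using that unfolding B_def fine_slope_above_shift by simp
    qed
    moreover have "fine_slope_above (\<lambda>x. - (f x + c * x)) r x" if "x \<in> B p q" for x
    proof -
      have "r - (- c) = - p" unfolding r_def c_def by argo
      then show ?thesis
        using that fine_slope_above_shift[of "\<lambda>x. - f x" "- c" r x] unfolding B_def by simp
    qed
    ultimately have "measure lebesgue (B p q) = 0" by (rule AC_on_fine_slopes_negligible)
    then show ?thesis using meas by (simp add: negligible_iff_measure)
  qed
  define N where "N = {a, b} \<union> ({a<..<b} \<inter> {x. \<forall>n::nat. fine_slope_above f (real n) x})
     \<union> ({a<..<b} \<inter> {x. \<forall>n::nat. fine_slope_above (\<lambda>x. - f x) (real n) x})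
     \<union> (\<Union>(p, q)\<in>{(p, q). p \<in> \<rat> \<and> q \<in> \<rat> \<and> p < q}. B p q)"
  show ?thesis
  proof (rule that)
    have "countable {(p :: real, q). p \<in> \<rat> \<and> q \<in> \<rat> \<and> p < q}"
      by (rule countable_subset[of _ "\<rat> \<times> \<rat>"]) (auto intro: countable_rat)
    then have "negligible (\<Union>(p, q)\<in>{(p, q). p \<in> \<rat> \<and> q \<in> \<rat> \<and> p < q}. B p q)"
      by (intro negligible_countable_Union) (auto intro: B_negl)
    then show "negligible N"
      unfolding N_def using AC_on_unbounded_slope_negligible[OF f] AC_on_unbounded_slope_negligible[OF minus]
      by (auto intro!: negligible_Un)
  next
    fix x assume xN: "x \<in> {a..b} - N"
    then have x: "a < x" "x < b" unfolding N_def by auto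
    have cont: "isCont f x"
      using continuous_on_interior[OF AC_on_imp_continuous_on[OF f], of x] x by simp
    have one_sided: "(f \<longlongrightarrow> f x) (at_left x)" "(f \<longlongrightarrow> f x) (at_right x)"
      using cont by (simp_all add: isCont_def filterlim_at_split)
    \<comment> \<open>These are the \<open>p\<close> that all sufficiently short intervals around
      \<open>x\<close> respect as a lower bound for their slope. The supremum of this set, finite
      because of \<open>n\<close> and \<open>n'\<close>, is the lower derivate and will be the
      derivative.\<close>
    define slopes where "slopes = {p. \<not> fine_slope_above (\<lambda>x. - f x) (- p) x}"
    obtain n n' :: nat where n: "\<not> fine_slope_above f (real n) x"
      "\<not> fine_slope_above (\<lambda>x. - f x) (real n') x"
      using xN x unfolding N_def by auto
    have low: "\<exists>d>0. \<forall>s t. s < x \<and> x < t \<and> t - s < d \<longrightarrow> p * (t - s) \<le> f t - f s"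
      if "p \<in> slopes" for p
      using that unfolding slopes_def fine_slope_above_minus by force
    have upp: "\<exists>d>0. \<forall>s t. s < x \<and> x < t \<and> t - s < d \<longrightarrow> f t - f s \<le> q * (t - s)"
      if "\<not> fine_slope_above f q x" for q
      using that unfolding fine_slope_above_def by force
    have "- real n' \<in> slopes" using n(2) unfolding slopes_def by simp
    then have "slopes \<noteq> {}" by blast
    have bdd: "p \<le> real n" if p: "p \<in> slopes" for p
    proof -
      obtain d1 where d1: "d1 > 0" "\<And>s t. s < x \<Longrightarrow> x < t \<Longrightarrow> t - s < d1 \<Longrightarrow> p * (t - s) \<le> f t - f s"
        using low[OF p] by blast
      obtain d2 where d2: "d2 > 0" "\<And>s t. s < x \<Longrightarrow> x < t \<Longrightarrow> t - s < d2 \<Longrightarrow> f t - f s \<le> real n * (t - s)"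
        using upp[OF n(1)] by blast
      define h where "h = min d1 d2 / 3"
      have h: "h > 0" "2 * h < d1" "2 * h < d2" unfolding h_def using d1 d2 by auto
      have "p * (2 * h) \<le> f (x + h) - f (x - h)" using d1(2)[of "x - h" "x + h"] h by simp
      also have "\<dots> \<le> real n * (2 * h)" using d2(2)[of "x - h" "x + h"] h by simp
      finally show ?thesis using h(1) by simp
    qed
    define D where "D = Sup slopes"
    have D_bdd: "bdd_above slopes" using bdd by (rule bdd_aboveI)
    have "(f has_derivative (\<lambda>h. D * h)) (at x)"
      unfolding has_derivative_at_alt
    proof (intro conjI allI impI)
      show "bounded_linear ((*) D)" by (rule bounded_linear_mult_right)
    next
      fix e :: real assume e: "e > 0"
      obtain p where p: "p \<in> slopes" "D - e < p"
        using less_cSup_iff[OF \<open>slopes \<noteq> {}\<close> D_bdd, of "D - e"] e unfolding D_def by auto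
      \<comment> \<open>Two rationals are fitted between \<open>D\<close> and \<open>D + e\<close>.
        Since \<open>p'\<close> exceeds the supremum, slopes below \<open>p'\<close> occur on
        arbitrarily short intervals; as \<open>x\<close> avoids \<open>B p' q\<close>, slopes above
        \<open>q\<close> cannot.\<close>
      obtain p' where p': "p' \<in> \<rat>" "D < p'" "p' < D + e" using Rats_dense_in_real[of D "D + e"] e by auto
      obtain q where q: "q \<in> \<rat>" "p' < q" "q < D + e" using Rats_dense_in_real[of p' "D + e"] p' by auto
      have "p' \<notin> slopes" using p'(2) cSup_upper[OF _ D_bdd, of p'] unfolding D_def by linarith
      then have "x \<notin> {x. fine_slope_above f q x}"
        using xN x p' q unfolding N_def B_def slopes_def by auto
      then have nq: "\<not> fine_slope_above f q x" by simp
      obtain d1 where d1: "d1 > 0" "\<And>s t. s < x \<Longrightarrow> x < t \<Longrightarrow> t - s < d1 \<Longrightarrow> p * (t - s) \<le> f t - f s"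
        using low[OF p(1)] by blast
      obtain d2 where d2: "d2 > 0" "\<And>s t. s < x \<Longrightarrow> x < t \<Longrightarrow> t - s < d2 \<Longrightarrow> f t - f s \<le> q * (t - s)"
        using upp[OF nq] by blast
      define d where "d = min d1 d2"
      have d: "d > 0" "d \<le> d1" "d \<le> d2" unfolding d_def using d1 d2 by simp_all
      \<comment> \<open>The bounds hold for intervals with \<open>x\<close> strictly inside; letting
        the left end tend to \<open>x\<close> and using continuity of \<open>f\<close> makes
        \<open>x\<close> an endpoint, as the difference quotient requires.\<close>
      have right: "p * (t - x) \<le> f t - f x \<and> f t - f x \<le> q * (t - x)" if t: "x < t" "t - x < d" for t
      proof
        have ev: "\<forall>\<^sub>F s in at_left x. s < x \<and> t - s < d"
          by (rule eventually_mono[OF eventually_at_left_real[of "t - d" x]]) (use t in auto)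
        have lim: "((\<lambda>s. f t - f s - c * (t - s)) \<longlongrightarrow> f t - f x - c * (t - x)) (at_left x)" for c
          by (intro tendsto_intros one_sided)
        have "0 \<le> f t - f x - p * (t - x)"
        proof (rule tendsto_lowerbound[OF lim eventually_mono[OF ev]])
          fix s assume "s < x \<and> t - s < d"
          then show "0 \<le> f t - f s - p * (t - s)"
            using d1(2)[of s t] d t by (simp add: algebra_simps)
        qed simp
        then show "p * (t - x) \<le> f t - f x" by simp
        have "f t - f x - q * (t - x) \<le> 0"
        proof (rule tendsto_upperbound[OF lim eventually_mono[OF ev]])
          fix s assume "s < x \<and> t - s < d"
          then show "f t - f s - q * (t - s) \<le> 0"
            using d2(2)[of s t] d t by (simp add: algebra_simps)
        qed simp
        then show "f t - f x \<le> q * (t - x)" by simp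
      qed
      have left: "p * (x - s) \<le> f x - f s \<and> f x - f s \<le> q * (x - s)" if s: "s < x" "x - s < d" for s
      proof
        have ev: "\<forall>\<^sub>F t in at_right x. x < t \<and> t - s < d"
          by (rule eventually_mono[OF eventually_at_right_real[of x "s + d"]]) (use s in auto)
        have lim: "((\<lambda>t. f t - f s - c * (t - s)) \<longlongrightarrow> f x - f s - c * (x - s)) (at_right x)" for c
          by (intro tendsto_intros one_sided)
        have "0 \<le> f x - f s - p * (x - s)"
        proof (rule tendsto_lowerbound[OF lim eventually_mono[OF ev]])
          fix t assume "x < t \<and> t - s < d"
          then show "0 \<le> f t - f s - p * (t - s)"
            using d1(2)[of s t] d s by (simp add: algebra_simps)
        qed simp
        then show "p * (x - s) \<le> f x - f s" by simp
        have "f x - f s - q * (x - s) \<le> 0"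
        proof (rule tendsto_upperbound[OF lim eventually_mono[OF ev]])
          fix t assume "x < t \<and> t - s < d"
          then show "f t - f s - q * (t - s) \<le> 0"
            using d2(2)[of s t] d s by (simp add: algebra_simps)
        qed simp
        then show "f x - f s \<le> q * (x - s)" by simp
      qed
      have pq: "D * h - e * h \<le> p * h" "q * h \<le> D * h + e * h" if "h \<ge> 0" for h
        using mult_right_mono[of "D - e" p h] mult_right_mono[of q "D + e" h] that p(2) q(3)
        by (simp_all add: left_diff_distrib distrib_right)
      show "\<exists>d>0. \<forall>y. norm (y - x) < d \<longrightarrow> norm (f y - f x - D * (y - x)) \<le> e * norm (y - x)"
      proof (rule exI[of _ d], intro conjI allI impI)
        fix y assume y: "norm (y - x) < d"
        show "norm (f y - f x - D * (y - x)) \<le> e * norm (y - x)"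
        proof (cases y x rule: linorder_cases)
          case less
          have "norm (f y - f x - D * (y - x)) = \<bar>f x - f y - D * (x - y)\<bar>"
            unfolding real_norm_def abs_eq_iff by (simp add: algebra_simps)
          moreover have "norm (y - x) = x - y" using less by simp
          ultimately show ?thesis using left[of y] pq[of "x - y"] y less by (auto simp: abs_le_iff)
        next
          case greater
          have "norm (y - x) = y - x" using greater by simp
          then show ?thesis using right[of y] pq[of "y - x"] y greater by (auto simp: abs_le_iff)
        qed simp
      qed (rule d(1))
    qed
    then show "f field_differentiable (at x)"
      unfolding field_differentiable_def has_field_derivative_def by blast
  qed
qed

section \<open>Fractional integrals as convolutions\<close>

text \<open>The power kernel, cut off so that it is integrable on the whole line. With
  \<open>c = b - a\<close> the cut is invisible for arguments in \<open>{a..b}\<close>, and the left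
  and right fractional integrals become integrals against
  \<open>trunc_kernel \<alpha> c (\<sigma> * (t - x))\<close> with \<sigma> = -1 and \<sigma> = 1
  respectively.\<close>

definition trunc_kernel :: "real \<Rightarrow> real \<Rightarrow> real \<Rightarrow> real" where
  "trunc_kernel \<alpha> c u = indicator {0..c} u * u powr (\<alpha> - 1)"

definition extend0 :: "real \<Rightarrow> real \<Rightarrow> (real \<Rightarrow> real) \<Rightarrow> real \<Rightarrow> real" where
  "extend0 a b f t = indicator {a..b} t * f t"

lemma borel_measurable_trunc_kernel [measurable]: "trunc_kernel \<alpha> c \<in> borel_measurable borel"
  unfolding trunc_kernel_def by measurable

lemma trunc_kernel_nonneg: "trunc_kernel \<alpha> c u \<ge> 0"
  unfolding trunc_kernel_def by simp

lemma norm_trunc_kernel_mult_le: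
  assumes "\<bar>y\<bar> \<le> M"
  shows "norm (trunc_kernel \<alpha> c u * y) \<le> M * trunc_kernel \<alpha> c u"
  using mult_right_mono[OF assms trunc_kernel_nonneg[of \<alpha> c u]]
  by (simp add: abs_mult trunc_kernel_nonneg mult.commute)

lemma integrable_trunc_kernel:
  assumes "\<alpha> > 0"
  shows "integrable lborel (trunc_kernel \<alpha> c)"
proof (cases "c \<ge> 0")
  case True
  have "(\<lambda>u. u powr (\<alpha> - 1)) absolutely_integrable_on {0..c}"
    using integrable_on_powr_from_0[of "\<alpha> - 1" c] assms True
    by (intro nonnegative_absolutely_integrable_1) auto
  then have "integrable lebesgue (trunc_kernel \<alpha> c)"
    unfolding set_integrable_def trunc_kernel_def by simp
  then show ?thesis by (subst (asm) integrable_completion) auto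
next
  case False
  then have "trunc_kernel \<alpha> c = (\<lambda>u. 0)" by (auto simp: trunc_kernel_def)
  then show ?thesis by simp
qed

lemma extend0_measurable:
  assumes "continuous_on {a..b} f"
  shows "extend0 a b f \<in> borel_measurable borel"
  using borel_measurable_continuous_on_indicator[OF _ assms] unfolding extend0_def by simp

lemma extend0_bounded:
  assumes "continuous_on {a..b} f"
  obtains M where "M \<ge> 0" "\<And>t. \<bar>extend0 a b f t\<bar> \<le> M"
proof -
  have "bounded (f ` {a..b})" using compact_continuous_image[OF assms compact_Icc] by (rule compact_imp_bounded)
  then obtain M where "\<forall>y\<in>f ` {a..b}. norm y \<le> M" unfolding bounded_iff by blast
  then have M: "\<bar>f t\<bar> \<le> M" if "t \<in> {a..b}" for t using that by auto
  show ?thesis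
  proof (rule that[of "max M 0"])
    show "\<bar>extend0 a b f t\<bar> \<le> max M 0" for t
      using M[of t] by (cases "t \<in> {a..b}") (auto simp: extend0_def)
  qed simp
qed

lemma isCont_extend0:
  assumes "continuous_on {a..b} f" "t \<noteq> a" "t \<noteq> b"
  shows "isCont (extend0 a b f) t"
proof (cases "t \<in> {a<..<b}")
  case True
  have "isCont f t" using continuous_on_interior[OF assms(1)] True by simp
  moreover have "\<forall>\<^sub>F s in nhds t. extend0 a b f s = f s"
    using eventually_nhds_in_open[OF open_greaterThanLessThan True]
    by eventually_elim (auto simp: extend0_def)
  ultimately show ?thesis by (subst isCont_cong)
next
  case False
  then have t: "t \<in> - {a..b}" using assms by auto
  have "\<forall>\<^sub>F s in nhds t. extend0 a b f s = 0"
    using eventually_nhds_in_open[OF open_Compl[OF closed_atLeastAtMost] t]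
    by eventually_elim (auto simp: extend0_def)
  then show ?thesis by (subst isCont_cong) auto
qed

context
  fixes a b \<alpha> c \<sigma> :: real and f :: "real \<Rightarrow> real"
  assumes f: "continuous_on {a..b} f" and \<alpha>: "\<alpha> > 0" and \<sigma>: "\<sigma> = 1 \<or> \<sigma> = - 1"
begin

lemma integrable_trunc_kernel_shift:
  "integrable lborel (\<lambda>t. trunc_kernel \<alpha> c (\<sigma> * (t - x)))"
proof -
  have "integrable lborel (\<lambda>t. trunc_kernel \<alpha> c (- (\<sigma> * x) + \<sigma> * t))"
    using \<sigma> by (intro lborel_integrable_real_affine integrable_trunc_kernel \<alpha>) auto
  moreover have "- (\<sigma> * x) + \<sigma> * t = \<sigma> * (t - x)" for t by (simp add: algebra_simps)
  ultimately show ?thesis by simp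
qed

lemma integrable_trunc_kernel_mult:
  "integrable lborel (\<lambda>t. trunc_kernel \<alpha> c (\<sigma> * (t - x)) * extend0 a b f t)"
proof -
  note [measurable] = extend0_measurable[OF f]
  obtain M where M: "M \<ge> 0" "\<And>t. \<bar>extend0 a b f t\<bar> \<le> M" using extend0_bounded[OF f] by metis
  show ?thesis
  proof (rule Bochner_Integration.integrable_bound)
    show "integrable lborel (\<lambda>t. M * trunc_kernel \<alpha> c (\<sigma> * (t - x)))"
      by (intro integrable_mult_right integrable_trunc_kernel_shift)
    show "AE t in lborel. norm (trunc_kernel \<alpha> c (\<sigma> * (t - x)) * extend0 a b f t)
            \<le> norm (M * trunc_kernel \<alpha> c (\<sigma> * (t - x)))"
      using norm_trunc_kernel_mult_le[OF M(2)]
      by (intro always_eventually allI) (simp add: M(1) trunc_kernel_nonneg abs_mult)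
  qed measurable
qed

text \<open>Substituting t = x + \<sigma> u fixes the singularity at u = 0 and lets \<open>x\<close>
  enter only through the bounded factor \<open>extend0 a b f\<close>, so a multiple of the kernel
  dominates.\<close>

lemma continuous_trunc_kernel_integral:
  "continuous_on UNIV (\<lambda>x. \<integral>t. trunc_kernel \<alpha> c (\<sigma> * (t - x)) * extend0 a b f t \<partial>lborel)"
proof -
  note [measurable] = extend0_measurable[OF f]
  have ss: "\<sigma> * \<sigma> = 1" "\<bar>\<sigma>\<bar> = 1" "\<sigma> \<noteq> 0" using \<sigma> by auto
  have eq: "(\<integral>t. trunc_kernel \<alpha> c (\<sigma> * (t - x)) * extend0 a b f t \<partial>lborel)
      = (\<integral>u. trunc_kernel \<alpha> c u * extend0 a b f (x + \<sigma> * u) \<partial>lborel)" for x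
  proof -
    have "\<sigma> * (x + \<sigma> * u - x) = u" for u using \<sigma> by auto
    then show ?thesis
      using lborel_integral_real_affine[OF ss(3),
          of "\<lambda>t. trunc_kernel \<alpha> c (\<sigma> * (t - x)) * extend0 a b f t" x] ss(2)
      by (simp only: scaleR_one)
  qed
  obtain M where M: "M \<ge> 0" "\<And>t. \<bar>extend0 a b f t\<bar> \<le> M" using extend0_bounded[OF f] by metis
  show ?thesis
    unfolding eq continuous_on_sequentially
  proof (intro ballI allI impI)
    fix X :: "nat \<Rightarrow> real" and x assume "(\<forall>n. X n \<in> UNIV) \<and> X \<longlonglongrightarrow> x"
    then have X: "X \<longlonglongrightarrow> x" by blast
    show "((\<lambda>x. \<integral>u. trunc_kernel \<alpha> c u * extend0 a b f (x + \<sigma> * u) \<partial>lborel) \<circ> X)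
        \<longlonglongrightarrow> (\<integral>u. trunc_kernel \<alpha> c u * extend0 a b f (x + \<sigma> * u) \<partial>lborel)"
      unfolding o_def
    proof (rule integral_dominated_convergence[where w = "\<lambda>u. M * trunc_kernel \<alpha> c u"])
      show "integrable lborel (\<lambda>u. M * trunc_kernel \<alpha> c u)"
        by (intro integrable_mult_right integrable_trunc_kernel \<alpha>)
      show "AE u in lborel. norm (trunc_kernel \<alpha> c u * extend0 a b f (X n + \<sigma> * u)) \<le> M * trunc_kernel \<alpha> c u" for n
        by (intro always_eventually allI norm_trunc_kernel_mult_le M(2))
      \<comment> \<open>The two excluded points are those where \<open>x + \<sigma> * u\<close>
        meets \<open>a\<close> or \<open>b\<close>, where the extension by zero may jump.\<close>
      have "AE u in lborel. u \<noteq> \<sigma> * (a - x)" "AE u in lborel. u \<noteq> \<sigma> * (b - x)"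
        by (rule AE_lborel_singleton)+
      then show "AE u in lborel. (\<lambda>n. trunc_kernel \<alpha> c u * extend0 a b f (X n + \<sigma> * u))
          \<longlonglongrightarrow> trunc_kernel \<alpha> c u * extend0 a b f (x + \<sigma> * u)"
      proof eventually_elim
        case (elim u)
        have "x + \<sigma> * u \<noteq> a" "x + \<sigma> * u \<noteq> b" using elim \<sigma> by auto
        then have "isCont (extend0 a b f) (x + \<sigma> * u)" by (intro isCont_extend0 f)
        moreover have "(\<lambda>n. X n + \<sigma> * u) \<longlonglongrightarrow> x + \<sigma> * u" by (intro tendsto_intros X)
        ultimately have "(\<lambda>n. extend0 a b f (X n + \<sigma> * u)) \<longlonglongrightarrow> extend0 a b f (x + \<sigma> * u)"
          by (rule isCont_tendsto_compose)
        then show ?case by (intro tendsto_intros)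
      qed
    qed measurable
  qed
qed

end

context
  fixes a b \<alpha> x :: real and f :: "real \<Rightarrow> real"
  assumes f: "continuous_on {a..b} f" and \<alpha>: "\<alpha> > 0" and x: "x \<in> {a..b}"
begin

lemma left_integrand_eq:
  "(\<lambda>t. indicator {a..x} t *\<^sub>R ((x - t) powr (\<alpha> - 1) * f t))
    = (\<lambda>t. trunc_kernel \<alpha> (b - a) (- 1 * (t - x)) * extend0 a b f t)"
  using x by (auto simp: fun_eq_iff trunc_kernel_def extend0_def indicator_def)

lemma right_integrand_eq:
  "(\<lambda>t. indicator {x..b} t *\<^sub>R ((t - x) powr (\<alpha> - 1) * f t))
    = (\<lambda>t. trunc_kernel \<alpha> (b - a) (1 * (t - x)) * extend0 a b f t)"
  using x by (auto simp: fun_eq_iff trunc_kernel_def extend0_def indicator_def)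

lemma RL_left_exists_continuous: "RL_left_exists a \<alpha> f x"
  unfolding RL_left_exists_def set_integrable_def left_integrand_eq
  using integrable_trunc_kernel_mult[OF f \<alpha>, of "- 1" "b - a" x]
  by (subst integrable_completion) (auto dest: borel_measurable_integrable)

lemma RL_right_exists_continuous: "RL_right_exists b \<alpha> f x"
  unfolding RL_right_exists_def set_integrable_def right_integrand_eq
  using integrable_trunc_kernel_mult[OF f \<alpha>, of 1 "b - a" x]
  by (subst integrable_completion) (auto dest: borel_measurable_integrable)

lemma RL_left_int_eq_trunc_kernel:
  "RL_left_int a \<alpha> f x
    = 1 / Gamma \<alpha> * (\<integral>t. trunc_kernel \<alpha> (b - a) (- 1 * (t - x)) * extend0 a b f t \<partial>lborel)"
  unfolding RL_left_int_def set_lebesgue_integral_def left_integrand_eq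
  using integrable_trunc_kernel_mult[OF f \<alpha>, of "- 1" "b - a" x]
  by (subst integral_completion) (auto dest: borel_measurable_integrable)

lemma RL_right_int_eq_trunc_kernel:
  "RL_right_int b \<alpha> f x
    = 1 / Gamma \<alpha> * (\<integral>t. trunc_kernel \<alpha> (b - a) (1 * (t - x)) * extend0 a b f t \<partial>lborel)"
  unfolding RL_right_int_def set_lebesgue_integral_def right_integrand_eq
  using integrable_trunc_kernel_mult[OF f \<alpha>, of 1 "b - a" x]
  by (subst integral_completion) (auto dest: borel_measurable_integrable)

end

lemma continuous_on_RL_left_int:
  assumes "continuous_on {a..b} f" "\<alpha> > 0"
  shows "continuous_on {a..b} (RL_left_int a \<alpha> f)"
proof -
  have "continuous_on {a..b} (\<lambda>x. 1 / Gamma \<alpha> *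
      (\<integral>t. trunc_kernel \<alpha> (b - a) (- 1 * (t - x)) * extend0 a b f t \<partial>lborel))"
    using continuous_trunc_kernel_integral[OF assms, of "- 1" "b - a"]
    by (intro continuous_on_mult_left) (auto intro: continuous_on_subset)
  then show ?thesis
    using RL_left_int_eq_trunc_kernel[OF assms] by (subst continuous_on_cong) auto
qed

lemma continuous_on_RL_right_int:
  assumes "continuous_on {a..b} f" "\<alpha> > 0"
  shows "continuous_on {a..b} (RL_right_int b \<alpha> f)"
proof -
  have "continuous_on {a..b} (\<lambda>x. 1 / Gamma \<alpha> *
      (\<integral>t. trunc_kernel \<alpha> (b - a) (1 * (t - x)) * extend0 a b f t \<partial>lborel))"
    using continuous_trunc_kernel_integral[OF assms, of 1 "b - a"]
    by (intro continuous_on_mult_left) (auto intro: continuous_on_subset)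
  then show ?thesis
    using RL_right_int_eq_trunc_kernel[OF assms] by (subst continuous_on_cong) auto
qed

section \<open>Fractional integration by parts\<close>

lemma integral_continuous_eq_lborel:
  fixes g :: "real \<Rightarrow> real"
  assumes "continuous_on {a..b} g"
  shows "integral {a..b} g = (\<integral>x. indicator {a..b} x * g x \<partial>lborel)"
proof -
  have "set_integrable lborel {a..b} g"
    unfolding set_integrable_def by (rule borel_integrable_compact[OF compact_Icc assms])
  from set_borel_integral_eq_integral(2)[OF this] show ?thesis
    unfolding set_lebesgue_integral_def by simp
qed

text \<open>Both sides are iterated integrals of p(x) k(x - t) h(t), where the kernel restricts to
  the triangle t \<le> x: integrating over t gives the left integral of \<open>h\<close>,
  integrating over x the right integral of \<open>p\<close>.\<close>

lemma RL_integration_by_parts: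
  assumes p: "continuous_on {a..b} p" and h: "continuous_on {a..b} h" and \<alpha>: "\<alpha> > 0"
  shows "integral {a..b} (\<lambda>x. p x * RL_left_int a \<alpha> h x) = integral {a..b} (\<lambda>x. h x * RL_right_int b \<alpha> p x)"
proof -
  define k where "k = trunc_kernel \<alpha> (b - a)"
  define F where "F = (\<lambda>x t. extend0 a b p x * (k (x - t) * extend0 a b h t))"
  note [measurable] = extend0_measurable[OF p] extend0_measurable[OF h]
  have k_meas [measurable]: "k \<in> borel_measurable borel" unfolding k_def by measurable
  have habs: "continuous_on {a..b} (\<lambda>t. \<bar>h t\<bar>)" using h by (intro continuous_intros)
  have pabs: "continuous_on {a..b} (\<lambda>t. \<bar>p t\<bar>)" using p by (intro continuous_intros)
  have fst_int: "integrable lborel (\<lambda>t. F x t)" for x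
    unfolding F_def k_def using integrable_trunc_kernel_mult[OF h \<alpha>, of "- 1" "b - a" x] by simp
  have "integrable (lborel \<Otimes>\<^sub>M lborel) (\<lambda>(x, t). F x t)"
  proof (rule lborel_pair.Fubini_integrable)
    show "(\<lambda>(x, t). F x t) \<in> borel_measurable (lborel \<Otimes>\<^sub>M lborel)"
      unfolding F_def by measurable
    \<comment> \<open>The inner integral of the norm is \<bar>p\<bar> times the same kernel integral
      for \<bar>h\<bar>, thus continuous in \<open>x\<close> on the compact interval. This gives
      integrability on the product.\<close>
    have "norm (F x t) = extend0 a b (\<lambda>t. \<bar>p t\<bar>) x * (k (- 1 * (t - x)) * extend0 a b (\<lambda>t. \<bar>h t\<bar>) t)" for x t
      unfolding F_def k_def by (simp add: abs_mult trunc_kernel_nonneg extend0_def)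
    then have "(\<lambda>x. \<integral>t. norm (F x t) \<partial>lborel) = (\<lambda>x. indicator {a..b} x *\<^sub>R (\<bar>p x\<bar> *
        (\<integral>t. trunc_kernel \<alpha> (b - a) (- 1 * (t - x)) * extend0 a b (\<lambda>t. \<bar>h t\<bar>) t \<partial>lborel)))"
      by (simp add: fun_eq_iff k_def extend0_def)
    moreover have "integrable lborel \<dots>"
      using continuous_trunc_kernel_integral[OF habs \<alpha>, of "- 1" "b - a"]
      by (intro borel_integrable_compact compact_Icc continuous_on_mult pabs) (auto intro: continuous_on_subset)
    ultimately show "integrable lborel (\<lambda>x. \<integral>t. norm (case (x, t) of (x, t) \<Rightarrow> F x t) \<partial>lborel)" by simp
    show "AE x in lborel. integrable lborel (\<lambda>t. case (x, t) of (x, t) \<Rightarrow> F x t)"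
      using fst_int by simp
  qed
  then have fubini: "(\<integral>t. (\<integral>x. F x t \<partial>lborel) \<partial>lborel) = (\<integral>x. (\<integral>t. F x t \<partial>lborel) \<partial>lborel)"
    by (rule lborel_pair.Fubini_integral)
  have "integral {a..b} (\<lambda>x. p x * RL_left_int a \<alpha> h x)
      = (\<integral>x. indicator {a..b} x * (p x * RL_left_int a \<alpha> h x) \<partial>lborel)"
    by (intro integral_continuous_eq_lborel continuous_on_mult p continuous_on_RL_left_int h \<alpha>)
  also have "\<dots> = (\<integral>x. 1 / Gamma \<alpha> * (\<integral>t. F x t \<partial>lborel) \<partial>lborel)"
  proof (rule Bochner_Integration.integral_cong)
    show "indicator {a..b} x * (p x * RL_left_int a \<alpha> h x) = 1 / Gamma \<alpha> * (\<integral>t. F x t \<partial>lborel)" for x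
    proof (cases "x \<in> {a..b}")
      case True
      then show ?thesis unfolding RL_left_int_eq_trunc_kernel[OF h \<alpha> True] F_def k_def
        by (simp add: extend0_def)
    qed (simp add: F_def extend0_def)
  qed simp
  also have "\<dots> = (\<integral>t. 1 / Gamma \<alpha> * (\<integral>x. F x t \<partial>lborel) \<partial>lborel)" using fubini by simp
  also have "\<dots> = (\<integral>x. indicator {a..b} x * (h x * RL_right_int b \<alpha> p x) \<partial>lborel)"
  proof (rule Bochner_Integration.integral_cong)
    show "1 / Gamma \<alpha> * (\<integral>x. F x t \<partial>lborel) = indicator {a..b} t * (h t * RL_right_int b \<alpha> p t)" for t
    proof (cases "t \<in> {a..b}")
      case True
      have "F x t = h t * (k (1 * (x - t)) * extend0 a b p x)" for x
        unfolding F_def using True by (simp add: extend0_def)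
      then show ?thesis unfolding RL_right_int_eq_trunc_kernel[OF p \<alpha> True] k_def
        using True by simp
    qed (simp add: F_def extend0_def)
  qed simp
  also have "\<dots> = integral {a..b} (\<lambda>x. h x * RL_right_int b \<alpha> p x)"
    by (intro integral_continuous_eq_lborel[symmetric] continuous_on_mult h continuous_on_RL_right_int p \<alpha>)
  finally show ?thesis .
qed

section \<open>Variations by primitives\<close>

text \<open>For order 1 the kernel is \<open>(x - t) powr 0\<close>, which equals 1 except at t = x,
  where \<open>0 powr 0\<close> is 0.\<close>

lemma RL_left_int_one_eq_integral:
  assumes "continuous_on {a..b} h" "x \<in> {a..b}"
  shows "RL_left_int a 1 h x = integral {a..x} h"
proof -
  have "set_integrable lebesgue {a..x} (\<lambda>t. (x - t) powr (1 - 1) * h t)"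
    using RL_left_exists_continuous[OF assms(1) _ assms(2), of 1] unfolding RL_left_exists_def by simp
  then have "RL_left_int a 1 h x = integral {a..x} (\<lambda>t. (x - t) powr (1 - 1) * h t)"
    unfolding RL_left_int_def by (simp add: set_lebesgue_integral_eq_integral(2))
  also have "\<dots> = integral {a..x} h"
    by (rule integral_spike[of "{x}"]) auto
  finally show ?thesis .
qed

text \<open>The domain shrinks to the point \<open>a\<close>, and there
  \<open>0 powr (\<alpha> - 1)\<close> is 0 by convention, so the integrand vanishes identically for
  every \<open>h\<close>.\<close>

lemma RL_left_int_at_lower: "RL_left_int a \<alpha> h a = 0"
  unfolding RL_left_int_def set_lebesgue_integral_def
  by (subst Bochner_Integration.integral_cong[where N = lebesgue and g = "\<lambda>t. 0"]) (auto simp: indicator_def)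

lemma RL_right_int_at_upper: "RL_right_int b \<alpha> h b = 0"
  unfolding RL_right_int_def set_lebesgue_integral_def
  by (subst Bochner_Integration.integral_cong[where N = lebesgue and g = "\<lambda>t. 0"]) (auto simp: indicator_def)

lemma RL_left_int_one_AC_on:
  assumes h: "continuous_on {a..b} h"
  shows "AC_on a b (RL_left_int a 1 h)"
proof -
  have "bounded (h ` {a..b})"
    using compact_continuous_image[OF h compact_Icc] by (rule compact_imp_bounded)
  then obtain M where M: "\<forall>y\<in>h ` {a..b}. norm y \<le> M" unfolding bounded_iff by blast
  show ?thesis
  proof (rule Lipschitz_imp_AC_on)
    fix s t assume st: "a \<le> s" "s \<le> t" "t \<le> b"
    have "h integrable_on {a..t}"
      using h st by (intro integrable_continuous_real) (auto intro: continuous_on_subset)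
    then have "integral {a..s} h + integral {s..t} h = integral {a..t} h"
      using st by (intro Henstock_Kurzweil_Integration.integral_combine) auto
    moreover have "norm (integral {s..t} h) \<le> M * (t - s)"
      using h M st by (intro integral_bound) (auto intro: continuous_on_subset)
    ultimately show "\<bar>RL_left_int a 1 h t - RL_left_int a 1 h s\<bar> \<le> M * (t - s)"
      using st by (simp add: RL_left_int_one_eq_integral[OF h] real_norm_def)
  qed
qed

lemma RL_left_int_one_has_derivative:
  assumes h: "continuous_on {a..b} h" and x: "x \<in> {a<..<b}"
  shows "(RL_left_int a 1 h has_real_derivative h x) (at x)"
proof -
  have "((\<lambda>x. integral {a..x} h) has_real_derivative h x) (at x within {a..b})"
    using x by (intro integral_has_real_derivative h) auto
  then have "((\<lambda>x. integral {a..x} h) has_real_derivative h x) (at x)"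
    using x by (subst (asm) at_within_interior) auto
  then show ?thesis
    by (rule has_field_derivative_transform_within_open[OF _ open_greaterThanLessThan x])
      (simp add: RL_left_int_one_eq_integral[OF h])
qed

lemma RL_left_perturb:
  assumes F: "RL_left_exists a \<alpha> F x" and h: "continuous_on {a..b} h" and \<alpha>: "\<alpha> > 0"
    and x: "x \<in> {a..b}" and N: "negligible N" "\<And>t. t \<in> {a..b} - N \<Longrightarrow> G t = F t + c * h t"
  shows "RL_left_exists a \<alpha> G x" "RL_left_int a \<alpha> G x = RL_left_int a \<alpha> F x + c * RL_left_int a \<alpha> h x"
proof -
  let ?k = "\<lambda>t. (x - t) powr (\<alpha> - 1)"
  have hex: "set_integrable lebesgue {a..x} (\<lambda>t. ?k t * h t)"
    using RL_left_exists_continuous[OF h \<alpha> x] unfolding RL_left_exists_def .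
  have Fex: "set_integrable lebesgue {a..x} (\<lambda>t. ?k t * F t)" using F unfolding RL_left_exists_def .
  have sum: "set_integrable lebesgue {a..x} (\<lambda>t. ?k t * F t + c * (?k t * h t))"
    by (intro set_integral_add set_integrable_mult_right Fex hex)
  have eq: "?k t * G t = ?k t * F t + c * (?k t * h t)" if "t \<in> {a..x} - N" for t
    using N(2)[of t] that x by (simp add: algebra_simps)
  \<comment> \<open>\<open>G\<close> is an arbitrary modification on \<open>N\<close>; measurability
    and integrability pass to it because Lebesgue measure is complete.\<close>
  have Gex: "set_integrable lebesgue {a..x} (\<lambda>t. ?k t * G t)"
    by (rule absolutely_integrable_spike[OF sum N(1)]) (rule eq)
  then show "RL_left_exists a \<alpha> G x" unfolding RL_left_exists_def .
  have "(LINT t:{a..x}|lebesgue. ?k t * G t) = (LINT t:{a..x}|lebesgue. ?k t * F t + c * (?k t * h t))"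
    unfolding set_lebesgue_integral_eq_integral(2)[OF Gex] set_lebesgue_integral_eq_integral(2)[OF sum]
    by (rule integral_spike[OF N(1)]) (simp add: eq)
  also have "\<dots> = (LINT t:{a..x}|lebesgue. ?k t * F t) + c * (LINT t:{a..x}|lebesgue. ?k t * h t)"
    using Fex hex by (simp add: set_integral_add)
  finally show "RL_left_int a \<alpha> G x = RL_left_int a \<alpha> F x + c * RL_left_int a \<alpha> h x"
    unfolding RL_left_int_def by (simp add: algebra_simps)
qed

lemma RL_right_perturb:
  assumes F: "RL_right_exists b \<alpha> F x" and h: "continuous_on {a..b} h" and \<alpha>: "\<alpha> > 0"
    and x: "x \<in> {a..b}" and N: "negligible N" "\<And>t. t \<in> {a..b} - N \<Longrightarrow> G t = F t + c * h t"
  shows "RL_right_exists b \<alpha> G x" "RL_right_int b \<alpha> G x = RL_right_int b \<alpha> F x + c * RL_right_int b \<alpha> h x"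
proof -
  let ?k = "\<lambda>t. (t - x) powr (\<alpha> - 1)"
  have hex: "set_integrable lebesgue {x..b} (\<lambda>t. ?k t * h t)"
    using RL_right_exists_continuous[OF h \<alpha> x] unfolding RL_right_exists_def .
  have Fex: "set_integrable lebesgue {x..b} (\<lambda>t. ?k t * F t)" using F unfolding RL_right_exists_def .
  have sum: "set_integrable lebesgue {x..b} (\<lambda>t. ?k t * F t + c * (?k t * h t))"
    by (intro set_integral_add set_integrable_mult_right Fex hex)
  have eq: "?k t * G t = ?k t * F t + c * (?k t * h t)" if "t \<in> {x..b} - N" for t
    using N(2)[of t] that x by (simp add: algebra_simps)
  have Gex: "set_integrable lebesgue {x..b} (\<lambda>t. ?k t * G t)"
    by (rule absolutely_integrable_spike[OF sum N(1)]) (rule eq)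
  then show "RL_right_exists b \<alpha> G x" unfolding RL_right_exists_def .
  have "(LINT t:{x..b}|lebesgue. ?k t * G t) = (LINT t:{x..b}|lebesgue. ?k t * F t + c * (?k t * h t))"
    unfolding set_lebesgue_integral_eq_integral(2)[OF Gex] set_lebesgue_integral_eq_integral(2)[OF sum]
    by (rule integral_spike[OF N(1)]) (simp add: eq)
  also have "\<dots> = (LINT t:{x..b}|lebesgue. ?k t * F t) + c * (LINT t:{x..b}|lebesgue. ?k t * h t)"
    using Fex hex by (simp add: set_integral_add)
  finally show "RL_right_int b \<alpha> G x = RL_right_int b \<alpha> F x + c * RL_right_int b \<alpha> h x"
    unfolding RL_right_int_def by (simp add: algebra_simps)
qed

lemma AC_on_add_primitive_deriv_ae:
  assumes f: "AC_on a b f" and h: "continuous_on {a..b} h"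
  obtains N where "negligible N"
    "\<And>t. t \<in> {a..b} - N \<Longrightarrow> deriv (\<lambda>x. f x + c * RL_left_int a 1 h x) t = deriv f t + c * h t"
proof -
  obtain N where N: "negligible N" "\<And>x. x \<in> {a..b} - N \<Longrightarrow> f field_differentiable (at x)"
    using AC_on_differentiable_ae[OF f] by metis
  show ?thesis
  proof (rule that)
    \<comment> \<open>At the endpoints the two-sided derivative of the primitive would depend on
      values outside \<open>{a..b}\<close>.\<close>
    show "negligible (N \<union> {a, b})" using N(1) by (intro negligible_Un) auto
    fix t assume t: "t \<in> {a..b} - (N \<union> {a, b})"
    then have "f field_differentiable (at t)" using N(2) by blast
    then have "(f has_real_derivative deriv f t) (at t)" by (simp add: DERIV_deriv_iff_field_differentiable)
    moreover have "(RL_left_int a 1 h has_real_derivative h t) (at t)"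
      using t by (intro RL_left_int_one_has_derivative[OF h]) auto
    ultimately show "deriv (\<lambda>x. f x + c * RL_left_int a 1 h x) t = deriv f t + c * h t"
      by (intro DERIV_imp_deriv) (auto intro!: derivative_eq_intros)
  qed
qed

text \<open>The combined Caputo derivative of a primitive of \<open>h\<close>, expressed through
  \<open>h\<close>; the minus sign is that of \<open>caputo_right\<close>.\<close>

definition combined_RL :: "real \<Rightarrow> real \<Rightarrow> real \<Rightarrow> real \<Rightarrow> real \<Rightarrow> (real \<Rightarrow> real) \<Rightarrow> real \<Rightarrow> real" where
  "combined_RL a b \<alpha> \<beta> \<gamma> h x =
     \<gamma> * RL_left_int a (1 - \<alpha>) h x - (1 - \<gamma>) * RL_right_int b (1 - \<beta>) h x"

lemma ccaputo_add_primitive: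
  assumes f: "AC_on a b f" "ccaputo_exists a b \<alpha> \<beta> f x" and h: "continuous_on {a..b} h"
    and \<alpha>: "\<alpha> < 1" and \<beta>: "\<beta> < 1" and x: "x \<in> {a..b}"
  shows "ccaputo_exists a b \<alpha> \<beta> (\<lambda>t. f t + c * RL_left_int a 1 h t) x"
    "ccaputo a b \<alpha> \<beta> \<gamma> (\<lambda>t. f t + c * RL_left_int a 1 h t) x
       = ccaputo a b \<alpha> \<beta> \<gamma> f x + c * combined_RL a b \<alpha> \<beta> \<gamma> h x"
proof -
  obtain N where N: "negligible N"
    "\<And>t. t \<in> {a..b} - N \<Longrightarrow> deriv (\<lambda>x. f x + c * RL_left_int a 1 h x) t = deriv f t + c * h t"
    using AC_on_add_primitive_deriv_ae[OF f(1) h] by metis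
  have F: "RL_left_exists a (1 - \<alpha>) (deriv f) x" "RL_right_exists b (1 - \<beta>) (deriv f) x"
    using f(2) unfolding ccaputo_exists_def by auto
  have "1 - \<alpha> > 0" "1 - \<beta> > 0" using \<alpha> \<beta> by auto
  let ?D = "deriv (\<lambda>t. f t + c * RL_left_int a 1 h t)"
  note L = RL_left_perturb[where G = ?D, OF F(1) h \<open>1 - \<alpha> > 0\<close> x N]
  note R = RL_right_perturb[where G = ?D, OF F(2) h \<open>1 - \<beta> > 0\<close> x N]
  show "ccaputo_exists a b \<alpha> \<beta> (\<lambda>t. f t + c * RL_left_int a 1 h t) x"
    unfolding ccaputo_exists_def using L(1) R(1) by blast
  show "ccaputo a b \<alpha> \<beta> \<gamma> (\<lambda>t. f t + c * RL_left_int a 1 h t) x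
       = ccaputo a b \<alpha> \<beta> \<gamma> f x + c * combined_RL a b \<alpha> \<beta> \<gamma> h x"
  proof -
    have L2: "RL_left_int a (1 - \<alpha>) ?D x = RL_left_int a (1 - \<alpha>) (deriv f) x + c * RL_left_int a (1 - \<alpha>) h x"
      by (rule L(2))
    have R2: "RL_right_int b (1 - \<beta>) ?D x = RL_right_int b (1 - \<beta>) (deriv f) x + c * RL_right_int b (1 - \<beta>) h x"
      by (rule R(2))
    show ?thesis
      unfolding ccaputo_def caputo_left_def caputo_right_def combined_RL_def L2 R2
      by (simp add: algebra_simps)
  qed
qed

lemma continuous_on_combined_RL:
  assumes "continuous_on {a..b} h" "\<alpha> < 1" "\<beta> < 1"
  shows "continuous_on {a..b} (combined_RL a b \<alpha> \<beta> \<gamma> h)"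
  unfolding combined_RL_def[abs_def] using assms
  by (intro continuous_intros continuous_on_RL_left_int continuous_on_RL_right_int) auto

section \<open>Membership and size of the varied curves\<close>

lemma D_space_add_primitive:
  fixes y :: "real \<Rightarrow> real^'n" and l :: 'n
  assumes y: "y \<in> D_space a b \<alpha> \<beta> \<gamma>" and h: "continuous_on {a..b} h"
    and \<alpha>: "\<And>i. \<alpha> $ i < 1" and \<beta>: "\<And>i. \<beta> $ i < 1"
  defines "z \<equiv> \<lambda>c x. y x + (c * RL_left_int a 1 h x) *\<^sub>R axis l 1"
  shows "z c \<in> D_space a b \<alpha> \<beta> \<gamma>"
    "\<And>x. x \<in> {a..b} \<Longrightarrow> ccaputo_vec a b \<alpha> \<beta> \<gamma> (z c) x
       = ccaputo_vec a b \<alpha> \<beta> \<gamma> y x + (c * combined_RL a b (\<alpha> $ l) (\<beta> $ l) (\<gamma> $ l) h x) *\<^sub>R axis l 1"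
proof -
  have y_D: "AC_on a b (\<lambda>t. y t $ i)" "x \<in> {a..b} \<Longrightarrow> ccaputo_exists a b (\<alpha> $ i) (\<beta> $ i) (\<lambda>t. y t $ i) x"
    "continuous_on {a..b} (ccaputo_vec a b \<alpha> \<beta> \<gamma> y)" for i x
    using y unfolding D_space_def by auto
  have z_l: "(\<lambda>t. z c t $ l) = (\<lambda>t. y t $ l + c * RL_left_int a 1 h t)"
    unfolding z_def by (simp add: axis_def)
  have z_ne: "(\<lambda>t. z c t $ i) = (\<lambda>t. y t $ i)" if "i \<noteq> l" for i
    using that unfolding z_def by (simp add: axis_def)
  note add = ccaputo_add_primitive[OF y_D(1) y_D(2) h \<alpha> \<beta>]
  show vec: "ccaputo_vec a b \<alpha> \<beta> \<gamma> (z c) x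
       = ccaputo_vec a b \<alpha> \<beta> \<gamma> y x + (c * combined_RL a b (\<alpha> $ l) (\<beta> $ l) (\<gamma> $ l) h x) *\<^sub>R axis l 1"
    if x: "x \<in> {a..b}" for x
  proof (rule vec_eq_iff[THEN iffD2], rule allI)
    fix i
    show "ccaputo_vec a b \<alpha> \<beta> \<gamma> (z c) x $ i = (ccaputo_vec a b \<alpha> \<beta> \<gamma> y x
      + (c * combined_RL a b (\<alpha> $ l) (\<beta> $ l) (\<gamma> $ l) h x) *\<^sub>R axis l 1) $ i"
      using add(2)[OF x x] by (cases "i = l") (simp_all add: ccaputo_vec_def z_l z_ne axis_def)
  qed
  have "AC_on a b (\<lambda>t. z c t $ i)" for i
    using AC_on_lincomb[OF y_D(1)[of l] RL_left_int_one_AC_on[OF h]] y_D(1)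
    by (cases "i = l") (simp_all add: z_l z_ne)
  moreover have "ccaputo_exists a b (\<alpha> $ i) (\<beta> $ i) (\<lambda>t. z c t $ i) x" if "x \<in> {a..b}" for i x
    using add(1)[OF that that] y_D(2)[OF that] by (cases "i = l") (simp_all add: z_l z_ne)
  moreover have "continuous_on {a..b} (ccaputo_vec a b \<alpha> \<beta> \<gamma> (z c))"
  proof -
    have "continuous_on {a..b} (\<lambda>x. ccaputo_vec a b \<alpha> \<beta> \<gamma> y x
        + (c * combined_RL a b (\<alpha> $ l) (\<beta> $ l) (\<gamma> $ l) h x) *\<^sub>R axis l 1)"
      by (intro continuous_intros y_D(3) continuous_on_combined_RL h \<alpha> \<beta>)
    then show ?thesis by (subst continuous_on_cong[OF refl vec]) auto
  qed
  ultimately show "z c \<in> D_space a b \<alpha> \<beta> \<gamma>" unfolding D_space_def by blast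
qed

text \<open>The variation itself is the zero curve, varied; this yields its combined derivative,
  which the norm of the variation involves.\<close>

lemma zero_in_D_space: "(\<lambda>x. 0) \<in> D_space a b \<alpha> \<beta> \<gamma>"
  and ccaputo_vec_zero: "ccaputo_vec a b \<alpha> \<beta> \<gamma> (\<lambda>x. 0) = (\<lambda>x. 0)"
proof -
  have d: "deriv (\<lambda>x. 0 :: real) = (\<lambda>x. 0)" by simp
  show vec: "ccaputo_vec a b \<alpha> \<beta> \<gamma> (\<lambda>x. 0) = (\<lambda>x. 0)"
    by (simp add: fun_eq_iff vec_eq_iff ccaputo_vec_def ccaputo_def caputo_left_def caputo_right_def
        RL_left_int_def RL_right_int_def d)
  have "AC_on a b (\<lambda>x. 0)" using Lipschitz_imp_AC_on[of a b "\<lambda>x. 0" 0] by simp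
  then show "(\<lambda>x. 0) \<in> D_space a b \<alpha> \<beta> \<gamma>"
    by (simp add: D_space_def vec ccaputo_exists_def RL_left_exists_def RL_right_exists_def d)
qed

text \<open>Linearity of the bound in \<bar>c\<bar> brings the varied curves into any neighbourhood
  of the minimizer. Both the curve and its derivative are scalar functions times
  \<open>axis l 1\<close>, so homogeneity reduces an arbitrary norm \<nu> to bounds for continuous
  scalar functions.\<close>

lemma norm_1_inf_primitive_le:
  fixes \<alpha> \<beta> \<gamma> :: "real^'n" and l :: 'n
  assumes "a < b" and h: "continuous_on {a..b} h" and \<nu>: "is_norm \<nu>"
    and \<alpha>: "\<And>i. \<alpha> $ i < 1" and \<beta>: "\<And>i. \<beta> $ i < 1"
  obtains M where "\<And>c. norm_1_inf \<nu> a b \<alpha> \<beta> \<gamma> (\<lambda>x. (c * RL_left_int a 1 h x) *\<^sub>R axis l 1) \<le> \<bar>c\<bar> * M"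
proof -
  define \<zeta> where "\<zeta> = combined_RL a b (\<alpha> $ l) (\<beta> $ l) (\<gamma> $ l) h"
  have bnd: "\<exists>M. \<forall>x\<in>{a..b}. \<bar>f x\<bar> \<le> M" if "continuous_on {a..b} f" for f :: "real \<Rightarrow> real"
  proof -
    have "bounded (f ` {a..b})"
      using compact_continuous_image[OF that compact_Icc] by (rule compact_imp_bounded)
    then show ?thesis unfolding bounded_iff by auto
  qed
  obtain M1 where M1: "\<And>x. x \<in> {a..b} \<Longrightarrow> \<bar>RL_left_int a 1 h x\<bar> \<le> M1"
    using bnd[OF continuous_on_RL_left_int[OF h zero_less_one]] by blast
  obtain M2 where M2: "\<And>x. x \<in> {a..b} \<Longrightarrow> \<bar>\<zeta> x\<bar> \<le> M2"
    using bnd[OF continuous_on_combined_RL[OF h \<alpha> \<beta>]] unfolding \<zeta>_def by blast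
  let ?e = "\<nu> (axis l 1)"
  have scale_le: "\<nu> ((c * r) *\<^sub>R axis l 1) \<le> \<bar>c\<bar> * (m * ?e)" if "\<bar>r\<bar> \<le> m" for c r m
  proof -
    have "0 \<le> ?e" "\<nu> ((c * r) *\<^sub>R axis l 1) = \<bar>c * r\<bar> * ?e"
      using \<nu> unfolding is_norm_def by blast+
    moreover have "\<bar>c\<bar> * (\<bar>r\<bar> * ?e) \<le> \<bar>c\<bar> * (m * ?e)"
      using that \<open>0 \<le> ?e\<close> by (simp add: mult_left_mono mult_right_mono)
    ultimately show ?thesis by (simp add: abs_mult)
  qed
  have vec: "ccaputo_vec a b \<alpha> \<beta> \<gamma> (\<lambda>x. (c * RL_left_int a 1 h x) *\<^sub>R axis l 1) x
      = (c * \<zeta> x) *\<^sub>R axis l 1" if "x \<in> {a..b}" for c x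
    using D_space_add_primitive(2)[OF zero_in_D_space h \<alpha> \<beta> that, of \<gamma> c l]
    unfolding \<zeta>_def ccaputo_vec_zero by simp
  show ?thesis
  proof (rule that)
    fix c
    have "(SUP x\<in>{a..b}. \<nu> ((c * RL_left_int a 1 h x) *\<^sub>R axis l 1)) \<le> \<bar>c\<bar> * (M1 * ?e)"
    proof (rule cSUP_least)
      show "\<nu> ((c * RL_left_int a 1 h x) *\<^sub>R axis l 1) \<le> \<bar>c\<bar> * (M1 * ?e)" if "x \<in> {a..b}" for x
        by (rule scale_le[OF M1[OF that]])
    qed (use \<open>a < b\<close> in auto)
    moreover have "(SUP x\<in>{a..b}. \<nu> (ccaputo_vec a b \<alpha> \<beta> \<gamma> (\<lambda>x. (c * RL_left_int a 1 h x) *\<^sub>R axis l 1) x))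
        \<le> \<bar>c\<bar> * (M2 * ?e)"
    proof (rule cSUP_least)
      show "\<nu> (ccaputo_vec a b \<alpha> \<beta> \<gamma> (\<lambda>x. (c * RL_left_int a 1 h x) *\<^sub>R axis l 1) x) \<le> \<bar>c\<bar> * (M2 * ?e)"
        if "x \<in> {a..b}" for x
        unfolding vec[OF that] by (rule scale_le[OF M2[OF that]])
    qed (use \<open>a < b\<close> in auto)
    ultimately show "norm_1_inf \<nu> a b \<alpha> \<beta> \<gamma> (\<lambda>x. (c * RL_left_int a 1 h x) *\<^sub>R axis l 1)
        \<le> \<bar>c\<bar> * (M1 * ?e + M2 * ?e)"
      unfolding norm_1_inf_def by (simp add: distrib_left)
  qed
qed

section \<open>Partial derivatives and the first variation\<close>

lemma vec_update_eq_axis: "(\<chi> i. if i = l then s else v $ i) = v + (s - v $ l) *\<^sub>R axis l (1::real)"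
  by (simp add: vec_eq_iff axis_def)

text \<open>The coordinate line through the point changes only \<open>v\<close> and so stays in the
  domain. Hence the derivative within the domain gives an ordinary derivative along the line, also
  when \<open>x\<close> is an endpoint.\<close>

lemma partial_v_eq_blinfun:
  fixes L :: "real \<times> (real^'n) \<times> (real^'n) \<Rightarrow> real"
  assumes L: "\<forall>p\<in>{a..b} \<times> UNIV \<times> UNIV.
      (L has_derivative blinfun_apply (L' p)) (at p within {a..b} \<times> UNIV \<times> UNIV)"
    and x: "x \<in> {a..b}"
  shows "partial_v l L (x, u, v) = blinfun_apply (L' (x, u, v)) (0, 0, axis l 1)"
proof -
  define g where "g s = (x, u, v + (s - v $ l) *\<^sub>R axis l (1::real))" for s :: real
  have "(L has_derivative blinfun_apply (L' (g (v $ l)))) (at (g (v $ l)) within range g)"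
    by (rule has_derivative_subset[OF bspec[OF L]]) (use x in \<open>auto simp: g_def\<close>)
  moreover have "(g has_derivative (\<lambda>s. (0, 0, s *\<^sub>R axis l 1))) (at (v $ l))"
    unfolding g_def by (auto intro!: derivative_eq_intros)
  ultimately have "((\<lambda>s. L (g s)) has_derivative (\<lambda>s. blinfun_apply (L' (g (v $ l))) (0, 0, s *\<^sub>R axis l 1))) (at (v $ l))"
    by (rule has_derivative_in_compose[rotated])
  moreover have "blinfun_apply A (0, 0, s *\<^sub>R axis l 1) = blinfun_apply A (0, 0, axis l 1) * s"
    for A :: "(real \<times> (real^'n) \<times> (real^'n)) \<Rightarrow>\<^sub>L real" and s
    using blinfun.scaleR_right[of A s "(0, 0, axis l 1)"] by (simp add: scaleR_prod_def zero_prod_def)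
  ultimately have "((\<lambda>s. L (g s)) has_real_derivative blinfun_apply (L' (g (v $ l))) (0, 0, axis l 1)) (at (v $ l))"
    by (simp add: has_field_derivative_def)
  then show ?thesis
    unfolding partial_v_def by (simp add: vec_update_eq_axis g_def DERIV_imp_deriv)
qed

text \<open>Differentiation under the integral sign. For fixed \<open>x\<close> the parameter moves
  only the last two arguments of \<open>L\<close>, so the path stays in the domain and the
  derivative in \<open>c\<close> is two-sided even at \<open>x = a\<close> and
  \<open>x = b\<close>.\<close>

lemma has_derivative_integral_affine:
  fixes L :: "real \<times> (real^'n) \<times> (real^'n) \<Rightarrow> real" and e :: "real^'n"
  assumes L: "\<forall>p\<in>{a..b} \<times> UNIV \<times> UNIV.
      (L has_derivative blinfun_apply (L' p)) (at p within {a..b} \<times> UNIV \<times> UNIV)"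
    and L': "continuous_on ({a..b} \<times> UNIV \<times> UNIV) L'"
    and u: "continuous_on {a..b} u" and v: "continuous_on {a..b} v"
    and \<eta>: "continuous_on {a..b} \<eta>" and \<zeta>: "continuous_on {a..b} \<zeta>"
  defines "p \<equiv> \<lambda>c x. (x, u x + (c * \<eta> x) *\<^sub>R e, v x + (c * \<zeta> x) *\<^sub>R e)"
  shows "continuous_on {a..b} (\<lambda>x. L (p c x))"
    "((\<lambda>c. integral {a..b} (\<lambda>x. L (p c x))) has_real_derivative
       integral {a..b} (\<lambda>x. blinfun_apply (L' (x, u x, v x)) (0, \<eta> x *\<^sub>R e, \<zeta> x *\<^sub>R e))) (at 0)"
proof -
  let ?S = "{a..b} \<times> UNIV \<times> UNIV :: (real \<times> (real^'n) \<times> (real^'n)) set"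
  have Lc: "continuous_on ?S L"
    using L has_derivative_continuous unfolding continuous_on_eq_continuous_within by blast
  have pS: "p c x \<in> ?S" if "x \<in> {a..b}" for c x using that unfolding p_def by simp
  show cont: "continuous_on {a..b} (\<lambda>x. L (p c x))" for c
  proof (rule continuous_on_compose2[OF Lc])
    show "continuous_on {a..b} (p c)"
      unfolding p_def by (intro continuous_intros u v \<eta> \<zeta>)
  qed (use pS in blast)
  define D where "D c x = blinfun_apply (L' (p c x)) (0, \<eta> x *\<^sub>R e, \<zeta> x *\<^sub>R e)" for c x
  have "((\<lambda>c. integral (cbox a b) (\<lambda>x. L (p c x))) has_real_derivative integral (cbox a b) (D 0)) (at 0 within UNIV)"
  proof (rule leibniz_rule_field_derivative)
    fix c x :: real assume "x \<in> cbox a b"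
    then have x: "x \<in> {a..b}" by simp
    have "(L has_derivative blinfun_apply (L' (p c x))) (at (p c x) within range (\<lambda>c. p c x))"
      by (rule has_derivative_subset[OF bspec[OF L pS[OF x]]]) (use pS[OF x] in blast)
    moreover have "((\<lambda>c. p c x) has_derivative (\<lambda>c. (0, (c * \<eta> x) *\<^sub>R e, (c * \<zeta> x) *\<^sub>R e))) (at c)"
      unfolding p_def by (auto intro!: derivative_eq_intros)
    ultimately have "((\<lambda>c. L (p c x)) has_derivative
        (\<lambda>s. blinfun_apply (L' (p c x)) (0, (s * \<eta> x) *\<^sub>R e, (s * \<zeta> x) *\<^sub>R e))) (at c)"
      by (rule has_derivative_in_compose[rotated])
    moreover have "blinfun_apply (L' (p c x)) (0, (s * \<eta> x) *\<^sub>R e, (s * \<zeta> x) *\<^sub>R e) = D c x * s" for s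
      using blinfun.scaleR_right[of "L' (p c x)" s "(0, \<eta> x *\<^sub>R e, \<zeta> x *\<^sub>R e)"]
      unfolding D_def by (simp add: scaleR_prod_def)
    ultimately show "((\<lambda>c. L (p c x)) has_real_derivative D c x) (at c within UNIV)"
      by (simp add: has_field_derivative_def)
  next
    show "(\<lambda>x. L (p c x)) integrable_on cbox a b" for c
      using cont[of c] by (simp add: integrable_continuous_real)
    have "continuous_on (UNIV \<times> {a..b}) (\<lambda>q. p (fst q) (snd q))"
      unfolding p_def
      by (intro continuous_intros continuous_on_compose2[OF u] continuous_on_compose2[OF v]
          continuous_on_compose2[OF \<eta>] continuous_on_compose2[OF \<zeta>]) auto
    then have "continuous_on (UNIV \<times> {a..b}) (\<lambda>q. L' (p (fst q) (snd q)))"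
      by (rule continuous_on_compose2[OF L']) (auto simp: p_def)
    then have "continuous_on (UNIV \<times> {a..b}) (\<lambda>q. D (fst q) (snd q))"
      unfolding D_def
      by (intro continuous_intros continuous_on_compose2[OF \<eta>] continuous_on_compose2[OF \<zeta>]) auto
    then show "continuous_on (UNIV \<times> cbox a b) (\<lambda>(c, x). D c x)"
      by (simp add: case_prod_unfold)
  qed auto
  then show "((\<lambda>c. integral {a..b} (\<lambda>x. L (p c x))) has_real_derivative
       integral {a..b} (\<lambda>x. blinfun_apply (L' (x, u x, v x)) (0, \<eta> x *\<^sub>R e, \<zeta> x *\<^sub>R e))) (at 0)"
    unfolding D_def by (simp add: p_def)
qed

lemma D_space_imp_continuous_on:
  assumes "y \<in> D_space a b \<alpha> \<beta> \<gamma>"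
  shows "continuous_on {a..b} y"
proof -
  have "continuous_on {a..b} (\<lambda>x. \<chi> i. y x $ i)"
    using assms AC_on_imp_continuous_on unfolding D_space_def
    by (intro continuous_on_vec_lambda) blast
  then show ?thesis by simp
qed

lemma first_variation_eq_0:
  fixes \<alpha> \<beta> \<gamma> :: "real^'n" and l :: 'n
  assumes "a < b" and \<alpha>: "\<And>i. \<alpha> $ i < 1" and \<beta>: "\<And>i. \<beta> $ i < 1" and \<nu>: "is_norm \<nu>"
    and L: "\<forall>p\<in>{a..b} \<times> UNIV \<times> UNIV.
      (L has_derivative blinfun_apply (L' p)) (at p within {a..b} \<times> UNIV \<times> UNIV)"
    and L': "continuous_on ({a..b} \<times> UNIV \<times> UNIV) L'"
    and y: "local_minimizer (norm_1_inf \<nu> a b \<alpha> \<beta> \<gamma>) (action L a b \<alpha> \<beta> \<gamma>)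
           {z \<in> D_space a b \<alpha> \<beta> \<gamma>. z a = ya \<and> (\<forall>i. i \<noteq> l \<longrightarrow> z b $ i = yb $ i)} y"
    and h: "continuous_on {a..b} h"
  shows "integral {a..b} (\<lambda>x. blinfun_apply (L' (bracket a b \<alpha> \<beta> \<gamma> y x))
      (0, RL_left_int a 1 h x *\<^sub>R axis l 1, combined_RL a b (\<alpha> $ l) (\<beta> $ l) (\<gamma> $ l) h x *\<^sub>R axis l 1)) = 0"
proof -
  define \<eta> where "\<eta> = RL_left_int a 1 h"
  define \<zeta> where "\<zeta> = combined_RL a b (\<alpha> $ l) (\<beta> $ l) (\<gamma> $ l) h"
  define z where "z c x = y x + (c * \<eta> x) *\<^sub>R axis l 1" for c x
  define C where "C = ccaputo_vec a b \<alpha> \<beta> \<gamma> y"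
  have yD: "y \<in> D_space a b \<alpha> \<beta> \<gamma>" "y a = ya" "\<And>i. i \<noteq> l \<Longrightarrow> y b $ i = yb $ i"
    using y unfolding local_minimizer_def by auto
  obtain \<delta> where \<delta>: "\<delta> > 0" "\<And>w. w \<in> D_space a b \<alpha> \<beta> \<gamma> \<Longrightarrow> w a = ya \<Longrightarrow> (\<And>i. i \<noteq> l \<Longrightarrow> w b $ i = yb $ i) \<Longrightarrow>
      norm_1_inf \<nu> a b \<alpha> \<beta> \<gamma> (\<lambda>x. w x - y x) < \<delta> \<Longrightarrow> action L a b \<alpha> \<beta> \<gamma> y \<le> action L a b \<alpha> \<beta> \<gamma> w"
    using y unfolding local_minimizer_def by blast
  have zD: "z c \<in> D_space a b \<alpha> \<beta> \<gamma>" for c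
    using D_space_add_primitive(1)[OF yD(1) h \<alpha> \<beta>] unfolding z_def[abs_def] \<eta>_def .
  have zC: "ccaputo_vec a b \<alpha> \<beta> \<gamma> (z c) x = C x + (c * \<zeta> x) *\<^sub>R axis l 1" if "x \<in> {a..b}" for c x
    using D_space_add_primitive(2)[OF yD(1) h \<alpha> \<beta> that] unfolding z_def[abs_def] \<eta>_def \<zeta>_def C_def .
  \<comment> \<open>The primitive vanishes at \<open>a\<close>, and at \<open>b\<close> only the
    free component \<open>l\<close> is altered.\<close>
  have z_bc: "z c a = ya" "\<And>i. i \<noteq> l \<Longrightarrow> z c b $ i = yb $ i" for c
    using yD unfolding z_def \<eta>_def by (auto simp: RL_left_int_at_lower axis_def)
  have y_cont: "continuous_on {a..b} y"
    by (rule D_space_imp_continuous_on[OF yD(1)])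
  have C_cont: "continuous_on {a..b} C" using yD(1) unfolding D_space_def C_def by blast
  have \<eta>_cont: "continuous_on {a..b} \<eta>" unfolding \<eta>_def by (rule continuous_on_RL_left_int[OF h]) simp
  have \<zeta>_cont: "continuous_on {a..b} \<zeta>" unfolding \<zeta>_def by (rule continuous_on_combined_RL[OF h \<alpha> \<beta>])
  define p where "p c x = (x, y x + (c * \<eta> x) *\<^sub>R axis l 1, C x + (c * \<zeta> x) *\<^sub>R axis l 1)" for c x
  note deriv = has_derivative_integral_affine[where e = "axis l 1", OF L L' y_cont C_cont \<eta>_cont \<zeta>_cont, folded p_def]
  have J: "action L a b \<alpha> \<beta> \<gamma> (z c) = integral {a..b} (\<lambda>x. L (p c x))" for c
  proof -
    have "action L a b \<alpha> \<beta> \<gamma> (z c) = (LINT x:{a..b}|lebesgue. L (p c x))"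
      unfolding action_def
      by (rule set_lebesgue_integral_cong) (auto simp: bracket_def zC p_def z_def)
    also have "\<dots> = integral {a..b} (\<lambda>x. L (p c x))"
      by (rule set_lebesgue_integral_eq_integral(2)[OF absolutely_integrable_continuous_real[OF deriv(1)]])
    finally show ?thesis .
  qed
  obtain M where M: "\<And>c. norm_1_inf \<nu> a b \<alpha> \<beta> \<gamma> (\<lambda>x. (c * \<eta> x) *\<^sub>R axis l 1) \<le> \<bar>c\<bar> * M"
    using norm_1_inf_primitive_le[OF \<open>a < b\<close> h \<nu> \<alpha> \<beta>, of \<gamma> l] unfolding \<eta>_def by metis
  \<comment> \<open>Then \<bar>c\<bar> < d forces \<bar>c\<bar> M \<le> \<bar>c\<bar> (\<bar>M\<bar>
    + 1) < \<delta>, whatever the sign of \<open>M\<close>.\<close>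
  define d where "d = \<delta> / (\<bar>M\<bar> + 1)"
  have d: "d > 0" using \<delta>(1) unfolding d_def by (simp add: add_nonneg_pos)
  have min: "integral {a..b} (\<lambda>x. L (p 0 x)) \<le> integral {a..b} (\<lambda>x. L (p c x))" if c: "\<bar>0 - c\<bar> < d" for c
  proof -
    have "\<bar>c\<bar> * M \<le> \<bar>c\<bar> * (\<bar>M\<bar> + 1)" by (intro mult_left_mono) auto
    also have "\<dots> < \<delta>" using c unfolding d_def by (simp add: field_simps add_nonneg_pos)
    finally have "norm_1_inf \<nu> a b \<alpha> \<beta> \<gamma> (\<lambda>x. z c x - y x) < \<delta>"
      using M[of c] unfolding z_def by simp
    then have "action L a b \<alpha> \<beta> \<gamma> y \<le> action L a b \<alpha> \<beta> \<gamma> (z c)" by (intro \<delta>(2) zD z_bc)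
    moreover have "z 0 = y" unfolding z_def by auto
    ultimately show ?thesis by (metis J)
  qed
  have "integral {a..b} (\<lambda>x. blinfun_apply (L' (x, y x, C x)) (0, \<eta> x *\<^sub>R axis l 1, \<zeta> x *\<^sub>R axis l 1)) = 0"
  proof (rule DERIV_local_min[OF deriv(2) d], intro allI impI)
    show "integral {a..b} (\<lambda>x. L (p 0 x)) \<le> integral {a..b} (\<lambda>x. L (p c x))" if "\<bar>0 - c\<bar> < d" for c
      by (rule min[OF that])
  qed
  then show ?thesis unfolding bracket_def \<eta>_def \<zeta>_def C_def .
qed

theorem mainTheorem2:
  fixes a b :: real
    and \<alpha> \<beta> \<gamma> :: "real^'n"
    and \<nu> :: "real^'n \<Rightarrow> real"
    and L :: "real \<times> (real^'n) \<times> (real^'n) \<Rightarrow> real"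
    and ya yb :: "real^'n"
    and l :: 'n
    and y :: "real \<Rightarrow> real^'n"
  assumes "a < b"
    and "\<And>i. 0 < \<alpha> $ i \<and> \<alpha> $ i < 1"
    and "\<And>i. 0 < \<beta> $ i \<and> \<beta> $ i < 1"
    and "\<And>i. 0 \<le> \<gamma> $ i \<and> \<gamma> $ i \<le> 1"
    and "is_norm \<nu>"
    and "C1_on L ({a..b} \<times> UNIV \<times> UNIV)"
    and "local_minimizer (norm_1_inf \<nu> a b \<alpha> \<beta> \<gamma>) (action L a b \<alpha> \<beta> \<gamma>)
           {z \<in> D_space a b \<alpha> \<beta> \<gamma>. z a = ya \<and> (\<forall>i. i \<noteq> l \<longrightarrow> z b $ i = yb $ i)} y"
  shows "\<gamma> $ l * RL_right_int b (1 - \<alpha> $ l)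
             (\<lambda>t. partial_v l L (bracket a b \<alpha> \<beta> \<gamma> y t)) b
         - (1 - \<gamma> $ l) * RL_left_int a (1 - \<beta> $ l)
             (\<lambda>t. partial_v l L (bracket a b \<alpha> \<beta> \<gamma> y t)) b = 0"
proof -
  have \<alpha>: "\<alpha> $ i < 1" and \<beta>: "\<beta> $ i < 1" for i using assms(2,3) by blast+
  then have pos: "1 - \<alpha> $ l > 0" "1 - \<beta> $ l > 0" by simp_all
  obtain L' where L: "\<forall>p\<in>{a..b} \<times> UNIV \<times> UNIV.
      (L has_derivative blinfun_apply (L' p)) (at p within {a..b} \<times> UNIV \<times> UNIV)"
    and L': "continuous_on ({a..b} \<times> UNIV \<times> UNIV) L'"
    using assms(6) unfolding C1_on_def by blast
  let ?p = "bracket a b \<alpha> \<beta> \<gamma> y"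
  \<comment> \<open>Along the curve, \<phi> is the partial derivative of \<open>L\<close> in the
    \<open>l\<close>-th fractional derivative and \<psi> the one in the \<open>l\<close>-th
    component of the curve.\<close>
  define \<phi> where "\<phi> x = blinfun_apply (L' (?p x)) (0, 0, axis l 1)" for x
  define \<psi> where "\<psi> x = blinfun_apply (L' (?p x)) (0, axis l 1, 0)" for x
  have yD: "y \<in> D_space a b \<alpha> \<beta> \<gamma>" using assms(7) unfolding local_minimizer_def by auto
  have "continuous_on {a..b} y"
    by (rule D_space_imp_continuous_on[OF yD])
  moreover have "continuous_on {a..b} (ccaputo_vec a b \<alpha> \<beta> \<gamma> y)" using yD unfolding D_space_def by blast
  ultimately have "continuous_on {a..b} ?p" unfolding bracket_def by (intro continuous_intros)
  then have "continuous_on {a..b} (\<lambda>x. L' (?p x))"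
    by (rule continuous_on_compose2[OF L']) (auto simp: bracket_def)
  then have \<phi>_cont: "continuous_on {a..b} \<phi>" and \<psi>_cont: "continuous_on {a..b} \<psi>"
    unfolding \<phi>_def \<psi>_def by (auto intro!: continuous_intros)
  define K where "K x = RL_right_int b 1 \<psi> x + \<gamma> $ l * RL_right_int b (1 - \<alpha> $ l) \<phi> x
     - (1 - \<gamma> $ l) * RL_left_int a (1 - \<beta> $ l) \<phi> x" for x
  have cont: "continuous_on {a..b} (RL_right_int b 1 \<psi>)" "continuous_on {a..b} (RL_right_int b (1 - \<alpha> $ l) \<phi>)"
    "continuous_on {a..b} (RL_left_int a (1 - \<beta> $ l) \<phi>)"
    by (intro continuous_on_RL_left_int continuous_on_RL_right_int \<phi>_cont \<psi>_cont pos zero_less_one)+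
  have K_cont: "continuous_on {a..b} K"
    unfolding K_def by (intro continuous_intros cont)
  have orth: "integral {a..b} (\<lambda>x. h x * K x) = 0" if h: "continuous_on {a..b} h" for h
  proof -
    let ?A = "RL_left_int a 1 h" and ?B = "RL_left_int a (1 - \<alpha> $ l) h" and ?D = "RL_right_int b (1 - \<beta> $ l) h"
    have hcont: "continuous_on {a..b} ?A" "continuous_on {a..b} ?B" "continuous_on {a..b} ?D"
      by (intro continuous_on_RL_left_int continuous_on_RL_right_int h pos zero_less_one)+
    have split: "blinfun_apply (L' (?p x)) (0, r *\<^sub>R axis l 1, s *\<^sub>R axis l 1) = \<psi> x * r + \<phi> x * s" for x r s
    proof -
      have "(0, r *\<^sub>R axis l 1, s *\<^sub>R axis l 1) = r *\<^sub>R (0 :: real, axis l (1::real), 0) + s *\<^sub>R (0, 0, axis l (1::real))"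
        by (simp add: scaleR_prod_def plus_prod_def)
      then show ?thesis
        unfolding \<phi>_def \<psi>_def by (simp only: blinfun.add_right blinfun.scaleR_right real_scaleR_def mult.commute)
    qed
    have "0 = integral {a..b} (\<lambda>x. \<psi> x * ?A x + \<phi> x * combined_RL a b (\<alpha> $ l) (\<beta> $ l) (\<gamma> $ l) h x)"
      using first_variation_eq_0[OF assms(1) \<alpha> \<beta> assms(5) L L' assms(7) h] unfolding split by simp
    also have "\<dots> = integral {a..b} (\<lambda>x. \<psi> x * ?A x + \<gamma> $ l * (\<phi> x * ?B x) - (1 - \<gamma> $ l) * (\<phi> x * ?D x))"
      unfolding combined_RL_def by (simp add: algebra_simps)
    also have "\<dots> = integral {a..b} (\<lambda>x. \<psi> x * ?A x) + \<gamma> $ l * integral {a..b} (\<lambda>x. \<phi> x * ?B x)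
        - (1 - \<gamma> $ l) * integral {a..b} (\<lambda>x. \<phi> x * ?D x)"
      by (subst integral_diff integral_add integral_mult_right integral_mult_right,
          (intro integrable_continuous_real continuous_intros \<phi>_cont \<psi>_cont hcont)+)+ simp
    \<comment> \<open>In the third term the roles are exchanged: integration by parts, read
      backwards, moves the right integral of \<open>h\<close> to a left integral of \<phi>.\<close>
    also have "\<dots> = integral {a..b} (\<lambda>x. h x * RL_right_int b 1 \<psi> x)
        + \<gamma> $ l * integral {a..b} (\<lambda>x. h x * RL_right_int b (1 - \<alpha> $ l) \<phi> x)
        - (1 - \<gamma> $ l) * integral {a..b} (\<lambda>x. h x * RL_left_int a (1 - \<beta> $ l) \<phi> x)"
      unfolding RL_integration_by_parts[OF \<psi>_cont h zero_less_one] RL_integration_by_parts[OF \<phi>_cont h pos(1)]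
        RL_integration_by_parts[OF h \<phi>_cont pos(2)] ..
    also have "\<dots> = integral {a..b} (\<lambda>x. h x * RL_right_int b 1 \<psi> x
        + \<gamma> $ l * (h x * RL_right_int b (1 - \<alpha> $ l) \<phi> x) - (1 - \<gamma> $ l) * (h x * RL_left_int a (1 - \<beta> $ l) \<phi> x))"
      by (subst integral_diff integral_add integral_mult_right integral_mult_right,
          (intro integrable_continuous_real continuous_intros cont h)+)+ simp
    also have "\<dots> = integral {a..b} (\<lambda>x. h x * K x)"
      unfolding K_def by (simp add: algebra_simps)
    finally show ?thesis by simp
  qed
  have "\<forall>x\<in>{a..b}. K x * K x = 0"
    using orth[OF K_cont]
      integral_eq_0_iff[OF continuous_on_mult[OF K_cont K_cont] \<open>a < b\<close> zero_le_square] by blast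
  then have "K b = 0" using \<open>a < b\<close> by simp
  \<comment> \<open>At \<open>b\<close> both right integrals extend over a single point and vanish,
    that of \<psi> as well as that of \<phi>, so \<open>K b = 0\<close> is a statement about the
    left integral alone.\<close>
  then have "(1 - \<gamma> $ l) * RL_left_int a (1 - \<beta> $ l) \<phi> b = 0"
    unfolding K_def RL_right_int_at_upper by simp
  moreover have "RL_left_int a (1 - \<beta> $ l) (\<lambda>t. partial_v l L (?p t)) b = RL_left_int a (1 - \<beta> $ l) \<phi> b"
    unfolding RL_left_int_def
    by (subst set_lebesgue_integral_cong[of "{a..b}" lebesgue _ "\<lambda>t. (b - t) powr (1 - \<beta> $ l - 1) * \<phi> t"])
      (auto simp: \<phi>_def bracket_def partial_v_eq_blinfun[OF L])
  ultimately show ?thesis by (simp add: RL_right_int_at_upper)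
qed

end
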